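(* Let $N\ge 2$ and consider an $N$-player game with cost functions $f_i:\mathbb{R}^N\to\mathbb{R}$, $i\in\mathcal{N}=\{1,\dots,N\}$, where the action $x_i\in\mathbb{R}$ of player $i$ is governed by $$\dot x_i=v_i,\qquad \dot v_i=b_iu_i+\phi_i(x_i)\theta_i,\quad i\in\mathcal{N},$$ with $v_i\in\mathbb{R}$ a state, $b_i\ne0$ an unknown constant, $\theta_i\in\mathbb{R}$ an unknown constant parameter and $\phi_i$ a known sufficiently smooth function. Suppose: (A1) each $f_i$ is sufficiently smooth and $\frac{\partial f_i}{\partial x_i}$ is globally Lipschitz with constant $l_i$; (A2) there is a constant $m>0$ with $(\mathbf{x}-\mathbf{z})^T(\mathcal{P}(\mathbf{x})-\mathcal{P}(\mathbf{z}))\ge m\|\mathbf{x}-\mathbf{z}\|^2$ for all $\mathbf{x},\mathbf{z}\in\mathbb{R}^N$, where $\mathcal{P}(\mathbf{x})=\left[\frac{\partial f_1(\mathbf{x})}{\partial x_1},\dots,\frac{\partial f_N(\mathbf{x})}{\partial x_N}\right]^T$; (A3) the players have an undirected and connected communication graph with adjacency matrix $[a_{ij}]$; (A4) for each $i$, $\phi_i(x_i)$ and $\frac{\partial\phi_i(x_i)}{\partial x_i}$ are bounded provided that $x_i$ is bounded; (A6) for each $i,j\in\mathcal{N}$, $\frac{\partial \nabla_i f_i(\mathbf{x})}{\partial x_j}$ is bounded given that $\mathbf{x}$ is bounded. Let the control input be $$u_i=N_0(k_i)\big(x_i-y_i+v_i+\phi_i(x_i)\hat\theta_i+(\dot x_i-\dot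 y_i)\big),\qquad N_0(k)=k^2\sin(k),$$ $$\dot k_i=(x_i-y_i+v_i)\big(x_i-y_i+v_i+\phi_i(x_i)\hat\theta_i+(\dot x_i-\dot y_i)\big),\qquad \dot{\hat\theta}_i=\phi_i(x_i)(x_i-y_i+v_i),$$ $$\dot y_i=-\nabla_i f_i(\mathbf{z}_i),\qquad \dot z_{ij}=-\delta_{ij}\Big(\sum_{k=1}^N a_{ik}(z_{ij}-z_{kj})+a_{ij}(z_{ij}-y_j)\Big),\quad i,j\in\mathcal{N},$$ where $\mathbf{z}_i=[z_{i1},\dots,z_{iN}]^T$, $\delta_{ij}=\delta\bar\delta_{ij}$, $\delta>0$ and $\bar\delta_{ij}>0$ are fixed constants. Then there exists a positive constant $\delta^*$ such that for each $\delta\in(\delta^*,\infty)$ (and every initial condition of the closed-loop system), $$\lim_{t\to\infty}\|\mathbf{x}(t)-\mathbf{x}^*\|=0,$$ and $k_i(t)$, $\hat\theta_i(t)$ stay bounded for all $i\in\mathcal{N}$, where $\mathbf{x}=[x_1,\dots,x_N]^T$ and $\mathbf{x}^*$ is the Nash equilibrium of the game.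
   Context: Notation: $\nabla_i f_i(\mathbf{z}_i)=\frac{\partial f_i(\mathbf{x})}{\partial x_i}\big|_{\mathbf{x}=\mathbf{z}_i}$ and $\nabla_i f_i(\mathbf{x})=\frac{\partial f_i(\mathbf{x})}{\partial x_i}$; the variables $k_i,\hat\theta_i,y_i,z_{ij}$ are real-valued. In the control law, $\dot x_i=v_i$ and $\dot y_i=-\nabla_i f_i(\mathbf{z}_i)$. An action profile $\mathbf{x}^*=(x_i^*,\mathbf{x}_{-i}^* )$ is a Nash equilibrium if for each $i\in\mathcal{N}$, $f_i(x_i^*,\mathbf{x}_{-i}^* )\le f_i(x_i,\mathbf{x}_{-i}^* )$ for all $x_i\in\mathbb{R}$, where $\mathbf{x}_{-i}=[x_1,\dots,x_{i-1},x_{i+1},\dots,x_N]^T$. The signs of the $b_i$ are unknown and need not coincide. Communication graph: node set $\mathcal{N}$, edge set $\mathcal{E}_d$; an edge $(i,j)\in\mathcal{E}_d$ means node $j$ can receive information from node $i$. The adjacency matrix satisfies $a_{ij}>0$ if $(j,i)\in\mathcal{E}_d$, $a_{ij}=0$ otherwise, and $a_{ii}=0$; for an undirected graph $a_{ij}=a_{ji}$. An undirected graph is connected if there is a path between any two distinct nodes. *)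

theory Defs
  imports "HOL-Analysis.Analysis"
begin

definition replace :: "real ^ 'n \<Rightarrow> 'n \<Rightarrow> real \<Rightarrow> real ^ 'n" where
  "replace x i s = (\<chi> j. if j = i then s else x $ j)"

definition partial :: "'n \<Rightarrow> (real ^ 'n \<Rightarrow> real) \<Rightarrow> real ^ 'n \<Rightarrow> real" where
  "partial i g x = deriv (\<lambda>s. g (replace x i s)) (x $ i)"

text \<open>The usual class \<open>C\<^sup>k\<close>: all partial derivatives up to order \<open>k\<close> exist and are continuous.
  The differentiability clause is needed because \<^const>\<open>deriv\<close> is total.\<close>

primrec Ck :: "nat \<Rightarrow> (real ^ 'n::finite \<Rightarrow> real) \<Rightarrow> bool" where
  "Ck 0 g \<longleftrightarrow> continuous_on UNIV g"
| "Ck (Suc k) g \<longleftrightarrow> continuous_on UNIV g \<and>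
     (\<forall>i. (\<forall>x. (\<lambda>s. g (replace x i s)) differentiable (at (x $ i))) \<and> Ck k (partial i g))"

definition pseudogradient :: "('n \<Rightarrow> real ^ 'n \<Rightarrow> real) \<Rightarrow> real ^ 'n \<Rightarrow> real ^ 'n" where
  "pseudogradient f x = (\<chi> i. partial i (f i) x)"

definition nash_equilibrium :: "('n \<Rightarrow> real ^ 'n \<Rightarrow> real) \<Rightarrow> real ^ 'n \<Rightarrow> bool" where
  "nash_equilibrium f xs \<longleftrightarrow> (\<forall>i s. f i xs \<le> f i (replace xs i s))"

text \<open>An edge \<open>(j, i)\<close> means that \<open>i\<close> receives information from \<open>j\<close>, so it carries the weight
  \<open>A $ i $ j\<close>.\<close>

definition adjacency_matrix :: "('n \<times> 'n) set \<Rightarrow> real ^ 'n ^ 'n \<Rightarrow> bool" where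
  "adjacency_matrix E A \<longleftrightarrow>
     (\<forall>i j. ((j, i) \<in> E \<longrightarrow> A $ i $ j > 0) \<and> ((j, i) \<notin> E \<longrightarrow> A $ i $ j = 0)) \<and>
     (\<forall>i. A $ i $ i = 0)"

definition undirected_connected :: "('n \<times> 'n) set \<Rightarrow> real ^ 'n ^ 'n \<Rightarrow> bool" where
  "undirected_connected E A \<longleftrightarrow>
     (\<forall>i j. A $ i $ j = A $ j $ i) \<and> (\<forall>i j. i \<noteq> j \<longrightarrow> (i, j) \<in> E\<^sup>+)"

definition bounded_on_bounded :: "('a::metric_space \<Rightarrow> 'b::metric_space) \<Rightarrow> bool" where
  "bounded_on_bounded g \<longleftrightarrow> (\<forall>B. bounded B \<longrightarrow> bounded (g ` B))"

definition nussbaum :: "real \<Rightarrow> real" where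
  "nussbaum k = k\<^sup>2 * sin k"

text \<open>Solutions on \<open>[0, \<infinity>)\<close> of the plant under the adaptive control law. Here \<open>dx\<close> and \<open>dy\<close> are the
  velocities of \<open>x\<^sub>i\<close> and \<open>y\<^sub>i\<close>, \<open>w\<close> is the common factor of the input \<open>u\<close> and of the gain
  update, and the rows \<open>z t $ i\<close> are the estimates held by player \<open>i\<close>.\<close>

definition closed_loop_solution ::
  "('n \<Rightarrow> real ^ 'n \<Rightarrow> real) \<Rightarrow> ('n \<Rightarrow> real \<Rightarrow> real) \<Rightarrow> ('n \<Rightarrow> real) \<Rightarrow> ('n \<Rightarrow> real) \<Rightarrow>
   real ^ 'n ^ 'n \<Rightarrow> ('n \<Rightarrow> 'n \<Rightarrow> real) \<Rightarrow>
   (real \<Rightarrow> real ^ 'n) \<Rightarrow> (real \<Rightarrow> real ^ 'n) \<Rightarrow> (real \<Rightarrow> real ^ 'n) \<Rightarrow> (real \<Rightarrow> real ^ 'n) \<Rightarrow>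
   (real \<Rightarrow> real ^ 'n) \<Rightarrow> (real \<Rightarrow> real ^ 'n::finite ^ 'n) \<Rightarrow> bool" where
  "closed_loop_solution f \<phi> b \<theta> A \<delta> x v k \<theta>h y z \<longleftrightarrow>
     (\<forall>t\<ge>0. \<forall>i.
        (let dx = v t $ i;
             dy = - partial i (f i) (z t $ i);
             e = x t $ i - y t $ i + v t $ i;
             w = e + \<phi> i (x t $ i) * \<theta>h t $ i + (dx - dy);
             u = nussbaum (k t $ i) * w
         in ((\<lambda>s. x s $ i) has_real_derivative dx) (at t within {0..}) \<and>
            ((\<lambda>s. v s $ i) has_real_derivative b i * u + \<phi> i (x t $ i) * \<theta> i)
              (at t within {0..}) \<and>
            ((\<lambda>s. k s $ i) has_real_derivative e * w) (at t within {0..}) \<and>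
            ((\<lambda>s. \<theta>h s $ i) has_real_derivative \<phi> i (x t $ i) * e) (at t within {0..}) \<and>
            ((\<lambda>s. y s $ i) has_real_derivative dy) (at t within {0..}) \<and>
            (\<forall>j. ((\<lambda>s. z s $ i $ j) has_real_derivative
                    - \<delta> i j * ((\<Sum>l\<in>UNIV. A $ i $ l * (z t $ i $ j - z t $ l $ j))
                              + A $ i $ j * (z t $ i $ j - y t $ j))) (at t within {0..}))))"

end

theory Submission
  imports Defs
begin

text \<open>
The closed loop is a cascade. The references \<open>y\<close> and the estimates \<open>z\<close> form an autonomous system
(\<open>estimation_loop\<close>), and the remaining states of each player form a small system that is driven by the
component \<open>y $ i\<close> and its velocity alone (\<open>player_loop\<close>). The two levels are analysed one after the other.

The estimation loop has a globally Lipschitz right-hand side. Its equilibrium is the zero of the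
strongly monotone pseudogradient, which exists by a contraction argument
(\<open>strongly_monotone_has_zero\<close>) and is the Nash equilibrium (\<open>nash_equilibrium_iff\<close>). On a connected
graph the consensus dynamics of the estimates is governed by a positive definite quadratic form
(\<open>consensus_form_coercive\<close>); for large \<open>\<delta>\<close> it is fast enough to dominate the errors that the players make
by evaluating their gradients at estimates, and a quadratic Lyapunov function decays exponentially
(\<open>lyapunov_decrease\<close>). Hence \<open>y\<close> tends to the equilibrium and its velocity to zero.

For a single player put \<open>e = x - y + v\<close> and let \<open>V\<close> be half the sum of the squares of \<open>e\<close> and of the parameter
error. Then \<open>V' = (b N(k) + 1) k' - e\<^sup>2\<close>, so \<open>V\<close> plus the integral of \<open>e\<^sup>2\<close> is a function of the gain \<open>k\<close> up to a
constant (\<open>player_energy_deriv\<close>). That function takes arbitrarily negative values on both sides of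
the origin whatever the sign of \<open>b\<close> (\<open>nussbaum_barrier\<close>), whereas \<open>V\<close> is nonnegative, so \<open>k\<close> is trapped and all
states are bounded (\<open>player_apriori_bound\<close>). The bounds yield global existence, by clamping the vector
field outside a box that solutions cannot leave (\<open>player_loop_exists\<close>). Finally \<open>e\<^sup>2\<close> is integrable with
bounded derivative, so \<open>e\<close> tends to zero by Barbalat's lemma, and \<open>x' = - x + y + e\<close> makes \<open>x\<close> follow \<open>y\<close> to the
equilibrium (\<open>player_loop_converges\<close>).
\<close>

section \<open>Global solutions of Lipschitz differential equations\<close>

lemma has_vector_derivative_half_line:
  fixes G :: "real \<Rightarrow> 'a::real_normed_vector"
  assumes "(G has_vector_derivative D) (at t within {0..t + 1})" "0 \<le> t"
  shows "(G has_vector_derivative D) (at t within {0..})"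
proof -
  have "at t within {0..t + 1} = at t within {0..}"
    by (rule at_within_nhd[of _ "{..<t + 1}"]) auto
  then show ?thesis using assms(1) by simp
qed

text \<open>Writing \<open>X t = X0 + exp (c t) Z t\<close> with \<open>c > L\<close> turns the integral equation into a fixed-point equation
for a bounded continuous \<open>Z\<close>. The weight makes the Picard operator a contraction with constant \<open>L / c\<close>
on the whole half-line at once, so no local solutions have to be glued together.\<close>

lemma global_solution_of_lipschitz_field:
  fixes F :: "real \<Rightarrow> 'a::banach \<Rightarrow> 'a"
  assumes lip: "\<And>t. 0 \<le> t \<Longrightarrow> L-lipschitz_on UNIV (F t)"
    and cont: "\<And>X. continuous_on {0..} (\<lambda>t. F t X)"
    and bdd: "\<And>t. 0 \<le> t \<Longrightarrow> norm (F t X0) \<le> M"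
  obtains X where "X 0 = X0"
    "\<And>t. 0 \<le> t \<Longrightarrow> (X has_vector_derivative F t (X t)) (at t within {0..})"
proof -
  define c where "c = L + 1"
  have L0: "0 \<le> L" using lip[of 0] by (auto simp: lipschitz_on_def)
  then have c: "0 < c" "L < c" by (auto simp: c_def)
  have M0: "0 \<le> M" using bdd[of 0] norm_ge_zero[of "F 0 X0"] by linarith
  \<comment> \<open>The right-hand side along the curve that \<open>Z\<close> represents.\<close>
  define H where "H Z t = F t (X0 + exp (c * t) *\<^sub>R apply_bcontfun Z t)"
    for Z :: "real \<Rightarrow>\<^sub>C 'a" and t
  have H_cont: "continuous_on {0..} (H Z)" for Z
    unfolding continuous_on_def
  proof
    fix s :: real assume s: "s \<in> {0..}"
    let ?X = "\<lambda>t. X0 + exp (c * t) *\<^sub>R apply_bcontfun Z t"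
    have "((\<lambda>t. dist (?X t) (?X s)) \<longlongrightarrow> 0) (at s within {0..})"
    proof -
      have "continuous_on {0..} ?X" by (intro continuous_intros) auto
      then have "(?X \<longlongrightarrow> ?X s) (at s within {0..})" using s by (auto simp: continuous_on_def)
      then show ?thesis by (rule tendsto_dist_iff[THEN iffD1])
    qed
    then have "((\<lambda>t. L * dist (?X t) (?X s)) \<longlongrightarrow> 0) (at s within {0..})"
      by (rule tendsto_mult_right_zero)
    then have "((\<lambda>t. F t (?X t) - F t (?X s)) \<longlongrightarrow> 0) (at s within {0..})"
    proof (rule Lim_null_comparison[rotated])
      have "norm (F t (?X t) - F t (?X s)) \<le> L * dist (?X t) (?X s)" if "t \<in> {0..}" for t
        unfolding dist_norm using lip that by (intro lipschitz_on_normD[of L UNIV]) auto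
      then show "\<forall>\<^sub>F t in at s within {0..}.
          norm (F t (?X t) - F t (?X s)) \<le> L * dist (?X t) (?X s)"
        unfolding eventually_at_filter by (intro always_eventually) blast
    qed
    moreover have "((\<lambda>t. F t (?X s)) \<longlongrightarrow> F s (?X s)) (at s within {0..})"
      using cont s by (auto simp: continuous_on_def)
    ultimately have "((\<lambda>t. (F t (?X t) - F t (?X s)) + F t (?X s)) \<longlongrightarrow> 0 + F s (?X s))
        (at s within {0..})"
      by (rule tendsto_add)
    moreover have "H Z = (\<lambda>t. F t (?X t))" by (simp add: H_def fun_eq_iff)
    ultimately show "(H Z \<longlongrightarrow> H Z s) (at s within {0..})" by simp
  qed
  have H_int: "H Z integrable_on {0..t}" for Z t
    by (rule integrable_continuous_real) (rule continuous_on_subset[OF H_cont], auto)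
  have I_der: "((\<lambda>t. integral {0..t} (H Z)) has_vector_derivative H Z t) (at t within {0..})"
    if "0 \<le> t" for Z t
    using that
    by (intro has_vector_derivative_half_line integral_has_vector_derivative
        continuous_on_subset[OF H_cont]) auto
  have exp_int: "((\<lambda>s. B * exp (c * s)) has_integral B * (exp (c * t) - 1) / c) {0..t}"
    if "0 \<le> t" for B t :: real
  proof -
    have "((\<lambda>s. B * exp (c * s)) has_integral (B * exp (c * t) / c - B * exp (c * 0) / c)) {0..t}"
      using that c
      by (intro fundamental_theorem_of_calculus)
        (auto simp flip: has_real_derivative_iff_has_vector_derivative
          intro!: derivative_eq_intros)
    then show ?thesis by (simp add: diff_divide_distrib right_diff_distrib)
  qed
  have I_bound: "norm (exp (- c * t) *\<^sub>R integral {0..t} g) \<le> B / c"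
    if t: "0 \<le> t" and B: "0 \<le> B" and g: "g integrable_on {0..t}"
      and le: "\<And>s. 0 \<le> s \<Longrightarrow> norm (g s) \<le> B * exp (c * s)"
    for t B and g :: "real \<Rightarrow> 'a"
  proof -
    have "norm (integral {0..t} g) \<le> integral {0..t} (\<lambda>s. B * exp (c * s))"
      using exp_int[OF t, of B] le
      by (intro integral_norm_bound_integral g) auto
    also have "\<dots> = B * (exp (c * t) - 1) / c"
      using exp_int[OF t] by (rule integral_unique)
    finally have "norm (integral {0..t} g) \<le> B * exp (c * t) / c"
      using B c by (simp add: field_simps)
    then have "exp (- c * t) * norm (integral {0..t} g) \<le> exp (- c * t) * (B * exp (c * t) / c)"
      by (rule mult_left_mono) simp
    also have "\<dots> = B / c" by (simp add: exp_minus)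
    finally show ?thesis by simp
  qed
  define I where "I Z t = exp (- c * t) *\<^sub>R integral {0..t} (H Z)" for Z t
  have H_bound: "norm (H Z s) \<le> (M + L * norm Z) * exp (c * s)" if "0 \<le> s" for Z s
  proof -
    have "norm (H Z s - F s X0) \<le> L * norm (exp (c * s) *\<^sub>R apply_bcontfun Z s)"
      using lipschitz_on_normD[OF lip[OF that], of "X0 + exp (c * s) *\<^sub>R apply_bcontfun Z s" X0]
      by (simp add: H_def)
    also have "\<dots> \<le> L * (exp (c * s) * norm Z)"
      using L0 norm_bounded[of Z s] by (intro mult_left_mono) auto
    finally have "norm (H Z s) \<le> M + L * (exp (c * s) * norm Z)"
      using bdd[OF that] norm_triangle_ineq2[of "H Z s" "F s X0"] by linarith
    moreover have "M * 1 \<le> M * exp (c * s)" using M0 c that by (intro mult_left_mono) auto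
    ultimately show ?thesis by (simp add: algebra_simps)
  qed
  \<comment> \<open>Bounded continuous functions live on the whole line, so negative times are sent to \<open>0\<close>.\<close>
  define T where "T Z = Bcontfun (\<lambda>t. I Z (max 0 t))" for Z
  have T: "apply_bcontfun (T Z) t = I Z (max 0 t)" for Z t
  proof -
    have "continuous_on {0..} (\<lambda>t. integral {0..t} (H Z))"
      using I_der by (intro continuous_on_vector_derivative) auto
    then have "continuous_on {0..} (I Z)" unfolding I_def by (intro continuous_intros)
    then have "continuous_on UNIV (\<lambda>t. I Z (max 0 t))"
      by (rule continuous_on_compose2) (auto intro!: continuous_intros)
    moreover have "norm (I Z (max 0 t)) \<le> (M + L * norm Z) / c" for t
      unfolding I_def using M0 L0 H_int H_bound by (intro I_bound) auto
    ultimately have "(\<lambda>t. I Z (max 0 t)) \<in> bcontfun"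
      by (auto simp: bcontfun_def bounded_iff)
    then show ?thesis by (simp add: T_def Bcontfun_inverse)
  qed
  have contraction: "dist (T Z) (T Z') \<le> L / c * dist Z Z'" for Z Z'
  proof (rule dist_bound)
    fix t :: real
    let ?t = "max 0 t"
    have "norm (H Z s - H Z' s) \<le> L * dist Z Z' * exp (c * s)" if "0 \<le> s" for s
    proof -
      have "norm (H Z s - H Z' s) \<le> L * norm (exp (c * s) *\<^sub>R (apply_bcontfun Z s - apply_bcontfun Z' s))"
        using lipschitz_on_normD[OF lip[OF that], of "X0 + exp (c * s) *\<^sub>R apply_bcontfun Z s"
            "X0 + exp (c * s) *\<^sub>R apply_bcontfun Z' s"]
        by (simp add: H_def algebra_simps)
      also have "\<dots> = L * (exp (c * s) * dist (apply_bcontfun Z s) (apply_bcontfun Z' s))"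
        by (simp add: dist_norm)
      also have "\<dots> \<le> L * (exp (c * s) * dist Z Z')"
        using L0 dist_bounded[of Z s Z'] by (intro mult_left_mono) auto
      finally show ?thesis by (simp add: mult_ac)
    qed
    then have "norm (exp (- c * ?t) *\<^sub>R integral {0..?t} (\<lambda>s. H Z s - H Z' s)) \<le> L * dist Z Z' / c"
      using L0 H_int by (intro I_bound integrable_diff) auto
    then show "dist (apply_bcontfun (T Z) t) (apply_bcontfun (T Z') t) \<le> L / c * dist Z Z'"
      using H_int by (simp add: T I_def dist_norm integral_diff algebra_simps)
  qed
  have "\<exists>!Z. T Z = Z"
    using contraction L0 c by (intro banach_fix_type[of "L / c"]) auto
  then obtain Z where Z: "T Z = Z" by blast
  define X where "X t = X0 + exp (c * t) *\<^sub>R apply_bcontfun Z t" for t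
  have X: "X t = X0 + integral {0..t} (H Z)" if "0 \<le> t" for t
    using T[of Z t] that by (simp add: Z X_def I_def exp_minus)
  show thesis
  proof
    show "X 0 = X0" using X[of 0] by simp
    fix t :: real assume t: "0 \<le> t"
    have "((\<lambda>t. X0 + integral {0..t} (H Z)) has_vector_derivative H Z t) (at t within {0..})"
      using I_der[OF t] by (auto intro!: derivative_eq_intros)
    then have "(X has_vector_derivative H Z t) (at t within {0..})"
      by (rule has_vector_derivative_transform[rotated 2]) (use t X in auto)
    then show "(X has_vector_derivative F t (X t)) (at t within {0..})"
      by (simp add: H_def X_def)
  qed
qed

section \<open>Scalar differential inequalities\<close>

text \<open>Derivatives are one-sided at the initial time, so monotonicity is stated for derivatives within a
set \<open>S\<close> that contains the interval.\<close>

lemma nondecreasing_if_deriv_nonneg: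
  fixes g :: "real \<Rightarrow> real"
  assumes der: "\<And>s. s \<in> {a..b} \<Longrightarrow> (g has_real_derivative g' s) (at s within S)"
    and S: "{a..b} \<subseteq> S"
    and nonneg: "\<And>s. s \<in> {a..b} \<Longrightarrow> 0 \<le> g' s"
    and ab: "a \<le> b"
  shows "g a \<le> g b"
proof -
  have der': "(g has_real_derivative g' s) (at s within {a..b})" if "s \<in> {a..b}" for s
    using der[OF that] S by (rule DERIV_subset)
  show ?thesis
  proof (rule DERIV_nonneg_imp_increasing_open[OF ab])
    fix s assume "a < s" "s < b"
    then show "\<exists>y. (g has_real_derivative y) (at s) \<and> 0 \<le> y"
      using der'[of s] nonneg[of s] at_within_Icc_at[of a s b] by auto
  next
    show "continuous_on {a..b} g"
      using der' by (rule DERIV_continuous_on)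
  qed
qed

text \<open>Gronwall's argument: the derivative of \<open>exp (c t) r t\<close> is nonpositive.\<close>

lemma exponential_comparison:
  fixes r :: "real \<Rightarrow> real"
  assumes der: "\<And>s. s \<in> {a..b} \<Longrightarrow> (r has_real_derivative r' s) (at s within S)"
    and S: "{a..b} \<subseteq> S"
    and le: "\<And>s. s \<in> {a..b} \<Longrightarrow> r' s \<le> - c * r s"
    and ab: "a \<le> b"
  shows "r b \<le> exp (- c * (b - a)) * r a"
proof -
  have "- (exp (c * a) * r a) \<le> - (exp (c * b) * r b)"
  proof (rule nondecreasing_if_deriv_nonneg[OF _ S _ ab])
    fix s assume s: "s \<in> {a..b}"
    show "((\<lambda>s. - (exp (c * s) * r s)) has_real_derivative
        - (exp (c * s) * (c * r s + r' s))) (at s within S)"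
      by (auto intro!: derivative_eq_intros der[OF s] simp: algebra_simps)
    show "0 \<le> - (exp (c * s) * (c * r s + r' s))"
      using le[OF s] by (simp add: mult_le_0_iff)
  qed
  then have "exp (- c * b) * (exp (c * b) * r b) \<le> exp (- c * b) * (exp (c * a) * r a)"
    by (intro mult_left_mono) auto
  then show ?thesis by (simp add: algebra_simps exp_diff exp_minus field_simps)
qed

text \<open>The filter \<open>r' = - r + g\<close> recurs below: the position follows its reference through it, driven by the
tracking error. It inherits bounds and convergence to zero from its input \<open>g\<close>.\<close>

lemma stable_filter_upper:
  fixes r g :: "real \<Rightarrow> real"
  assumes der: "\<And>s. s \<in> {a..b} \<Longrightarrow> (r has_real_derivative - r s + g s) (at s within S)"
    and S: "{a..b} \<subseteq> S"
    and le: "\<And>s. s \<in> {a..b} \<Longrightarrow> g s \<le> B"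
    and ab: "a \<le> b"
  shows "r b \<le> B + exp (a - b) * (r a - B)"
proof -
  have "r b - B \<le> exp (- 1 * (b - a)) * (r a - B)"
  proof (rule exponential_comparison[OF _ S _ ab])
    fix s assume s: "s \<in> {a..b}"
    show "((\<lambda>s. r s - B) has_real_derivative - r s + g s) (at s within S)"
      by (auto intro!: derivative_eq_intros der[OF s])
    show "- r s + g s \<le> - 1 * (r s - B)" using le[OF s] by simp
  qed
  then show ?thesis by simp
qed

lemma stable_filter_bound:
  fixes r g :: "real \<Rightarrow> real"
  assumes der: "\<And>s. s \<in> {a..b} \<Longrightarrow> (r has_real_derivative - r s + g s) (at s within S)"
    and S: "{a..b} \<subseteq> S"
    and le: "\<And>s. s \<in> {a..b} \<Longrightarrow> \<bar>g s\<bar> \<le> B"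
    and ab: "a \<le> b"
  shows "\<bar>r b\<bar> \<le> B + exp (a - b) * \<bar>r a\<bar>"
proof -
  have "0 \<le> B" using le[of a] ab by auto
  have up: "r b \<le> B + exp (a - b) * (r a - B)"
    using le by (intro stable_filter_upper[OF der S _ ab]) (auto simp: abs_le_iff)
  have lo: "- r b \<le> B + exp (a - b) * (- r a - B)"
  proof (rule stable_filter_upper[OF _ S _ ab])
    fix s assume s: "s \<in> {a..b}"
    show "((\<lambda>s. - r s) has_real_derivative - (- r s) + - g s) (at s within S)"
      by (auto intro!: derivative_eq_intros der[OF s])
    show "- g s \<le> B" using le[OF s] by auto
  qed
  have "exp (a - b) * (r a - B) \<le> exp (a - b) * \<bar>r a\<bar>"
    "exp (a - b) * (- r a - B) \<le> exp (a - b) * \<bar>r a\<bar>"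
    using \<open>0 \<le> B\<close> by (intro mult_left_mono; simp)+
  then show ?thesis using up lo by linarith
qed

lemma stable_filter_tendsto_0:
  fixes r g :: "real \<Rightarrow> real"
  assumes der: "\<And>t. 0 \<le> t \<Longrightarrow> (r has_real_derivative - r t + g t) (at t within {0..})"
    and g: "(g \<longlongrightarrow> 0) at_top"
  shows "(r \<longlongrightarrow> 0) at_top"
proof (rule tendstoI)
  fix \<epsilon> :: real assume \<epsilon>: "0 < \<epsilon>"
  have "\<forall>\<^sub>F t in at_top. \<bar>g t\<bar> < \<epsilon> / 2"
    using tendstoD[OF g, of "\<epsilon> / 2"] \<epsilon> by (simp add: dist_real_def)
  then obtain T where T: "\<And>t. T \<le> t \<Longrightarrow> \<bar>g t\<bar> < \<epsilon> / 2" by (auto simp: eventually_at_top_linorder)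
  define a where "a = max 0 T"
  have "((\<lambda>t. exp (- t)) \<longlongrightarrow> (0::real)) at_top"
    by (rule filterlim_compose[OF exp_at_bot filterlim_uminus_at_bot_at_top])
  then have "((\<lambda>t. exp a * \<bar>r a\<bar> * exp (- t)) \<longlongrightarrow> 0) at_top"
    by (rule tendsto_mult_right_zero)
  then have "((\<lambda>t. exp (a - t) * \<bar>r a\<bar>) \<longlongrightarrow> 0) at_top"
    by (simp add: exp_diff exp_minus field_simps)
  then have "\<forall>\<^sub>F t in at_top. exp (a - t) * \<bar>r a\<bar> < \<epsilon> / 2"
    using \<epsilon> by (intro order_tendstoD) auto
  moreover have "\<forall>\<^sub>F t in at_top. a \<le> t" by (rule eventually_ge_at_top)
  ultimately show "\<forall>\<^sub>F t in at_top. dist (r t) 0 < \<epsilon>"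
  proof eventually_elim
    case (elim t)
    have "\<bar>r t\<bar> \<le> \<epsilon> / 2 + exp (a - t) * \<bar>r a\<bar>"
      using elim(2) T by (intro stable_filter_bound[OF der, of a t]) (auto simp: a_def less_imp_le)
    then show ?case using elim by (simp add: dist_real_def)
  qed
qed

text \<open>Barbalat's lemma: if \<open>q\<close> were at least \<open>\<epsilon>\<close> at arbitrarily late times, its bounded derivative would keep it
above \<open>\<epsilon> / 2\<close> on intervals of a fixed length \<open>h\<close>, and each of them would add \<open>h \<epsilon> / 2\<close> to the bounded
nondecreasing primitive \<open>F\<close>.\<close>

lemma barbalat:
  fixes F q :: "real \<Rightarrow> real"
  assumes F: "\<And>t. 0 \<le> t \<Longrightarrow> (F has_real_derivative q t) (at t within {0..})"
    and q: "\<And>t. 0 \<le> t \<Longrightarrow> (q has_real_derivative q' t) (at t within {0..})"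
    and q_nonneg: "\<And>t. 0 \<le> t \<Longrightarrow> 0 \<le> q t"
    and q'_bound: "\<And>t. 0 \<le> t \<Longrightarrow> \<bar>q' t\<bar> \<le> M"
    and F_bound: "\<And>t. 0 \<le> t \<Longrightarrow> F t \<le> K"
  shows "(q \<longlongrightarrow> 0) at_top"
proof (rule tendstoI)
  fix \<epsilon> :: real assume \<epsilon>: "0 < \<epsilon>"
  have M: "0 \<le> M" using q'_bound[of 0] by simp
  \<comment> \<open>Short enough that \<open>q\<close> falls by at most \<open>\<epsilon> / 2\<close> within time \<open>h\<close>.\<close>
  define h where "h = \<epsilon> / (2 * (M + 1))"
  have h: "0 < h" using \<epsilon> M by (simp add: h_def)
  have Mh: "M * h \<le> \<epsilon> / 2" using \<epsilon> M by (simp add: h_def field_simps)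
  have F_mono: "F s \<le> F t" if "0 \<le> s" "s \<le> t" for s t
    using that F q_nonneg by (intro nondecreasing_if_deriv_nonneg[of s t F q "{0..}"]) auto
  have bdd: "bdd_above (F ` {0..})" using F_bound by (auto intro!: bdd_aboveI[of _ K])
  define S where "S = Sup (F ` {0..})"
  obtain T where T: "0 \<le> T" "S - h * (\<epsilon> / 2) < F T"
    using less_cSupD[of "F ` {0..}" "S - h * (\<epsilon> / 2)"] h \<epsilon> by (auto simp: S_def)
  have small: "q t < \<epsilon>" if t: "T \<le> t" for t
  proof (rule ccontr)
    assume "\<not> q t < \<epsilon>"
    then have qt: "\<epsilon> \<le> q t" by simp
    have t0: "0 \<le> t" using T t by simp
    have q_large: "\<epsilon> / 2 \<le> q s" if s: "s \<in> {t..t + h}" for s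
    proof -
      have "q t + M * t \<le> q s + M * s"
      proof (rule nondecreasing_if_deriv_nonneg[of t s "\<lambda>s. q s + M * s" "\<lambda>s. q' s + M" "{0..}"])
        fix u assume "u \<in> {t..s}"
        then have u: "0 \<le> u" using t0 by simp
        show "((\<lambda>s. q s + M * s) has_real_derivative q' u + M) (at u within {0..})"
          by (auto intro!: derivative_eq_intros q[OF u])
        show "0 \<le> q' u + M" using q'_bound[OF u] by linarith
      qed (use s t0 in auto)
      moreover have "M * (s - t) \<le> M * h" using s M by (intro mult_left_mono) auto
      ultimately show ?thesis using qt Mh by (simp add: algebra_simps)
    qed
    have "F t - \<epsilon> / 2 * t \<le> F (t + h) - \<epsilon> / 2 * (t + h)"
    proof (rule nondecreasing_if_deriv_nonneg[of t "t + h" "\<lambda>s. F s - \<epsilon> / 2 * s"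
          "\<lambda>s. q s - \<epsilon> / 2" "{0..}"])
      fix u assume u: "u \<in> {t..t + h}"
      then show "((\<lambda>s. F s - \<epsilon> / 2 * s) has_real_derivative q u - \<epsilon> / 2) (at u within {0..})"
        using t0 by (auto intro!: derivative_eq_intros F)
      show "0 \<le> q u - \<epsilon> / 2" using q_large[OF u] by simp
    qed (use h t0 in auto)
    then have "F T + h * (\<epsilon> / 2) \<le> F (t + h)"
      using F_mono[OF T(1) t] by (simp add: algebra_simps add_divide_distrib)
    moreover have "F (t + h) \<le> S"
      unfolding S_def using bdd h t0 by (intro cSUP_upper) auto
    ultimately show False using T by simp
  qed
  show "\<forall>\<^sub>F t in at_top. dist (q t) 0 < \<epsilon>"
    using eventually_ge_at_top[of T]
  proof eventually_elim
    case (elim t)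
    then show ?case using small[of t] q_nonneg[of t] T(1) by (simp add: dist_real_def)
  qed
qed

text \<open>A first-exit argument: at the first time at which \<open>g\<close> reaches \<open>R\<close>, it has been at most \<open>R\<close> throughout, and
the step hypothesis says that it is in fact below \<open>R\<close>.\<close>

lemma stays_below:
  fixes g :: "real \<Rightarrow> real"
  assumes cont: "continuous_on {0..T} g" and init: "g 0 < R"
    and step: "\<And>t. t \<in> {0..T} \<Longrightarrow> \<forall>s\<in>{0..t}. g s \<le> R \<Longrightarrow> g t < R"
    and t: "t \<in> {0..T}"
  shows "g t < R"
proof (rule ccontr)
  assume neg: "\<not> g t < R"
  define S where "S = {s \<in> {0..T}. g s \<in> {R..}}"
  have "compact S"
  proof (rule compact_eq_bounded_closed[THEN iffD2, OF conjI])
    show "bounded S" by (rule bounded_subset[OF bounded_closed_interval]) (auto simp: S_def)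
    have "S = {0..T} \<inter> g -` {R..}" by (auto simp: S_def)
    then show "closed S" using continuous_closed_preimage[OF cont, of "{R..}"] by simp
  qed
  moreover have "S \<noteq> {}" using neg t by (auto simp: S_def)
  ultimately obtain s where s: "s \<in> S" and least: "\<And>u. u \<in> S \<Longrightarrow> s \<le> u"
    using compact_attains_inf[of S] by metis
  have sT: "s \<in> {0..T}" "R \<le> g s" using s by (auto simp: S_def)
  obtain u where u: "0 \<le> u" "u \<le> s" "g u = R"
  proof -
    have "continuous_on {0..s} g" using continuous_on_subset[OF cont, of "{0..s}"] sT(1) by simp
    then show ?thesis using IVT'[of g 0 R s] init sT that by (metis atLeastAtMost_iff less_imp_le)
  qed
  have "u \<in> S" using u sT(1) by (simp add: S_def)
  then have "u = s" using least u(2) by fastforce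
  have "g w \<le> R" if "w \<in> {0..s}" for w
  proof (cases "w = s")
    case False
    then have "w \<notin> S" using least[of w] that by fastforce
    then show ?thesis using that sT(1) by (simp add: S_def)
  qed (use u \<open>u = s\<close> in simp)
  then have "g s < R" using step sT(1) by blast
  then show False using sT by simp
qed

section \<open>The Nussbaum gain\<close>

text \<open>The antiderivative of \<open>b N(k) + 1\<close>, where \<open>N\<close> is the Nussbaum function. Along the closed loop it bounds
the energy of a player up to a constant.\<close>

definition nussbaum_energy :: "real \<Rightarrow> real \<Rightarrow> real" where
  "nussbaum_energy b k = b * (2 * k * sin k + 2 * cos k - k\<^sup>2 * cos k) + k"

lemma nussbaum_energy_deriv:
  "(nussbaum_energy b has_real_derivative b * nussbaum k + 1) (at k)"
  unfolding nussbaum_energy_def[abs_def] nussbaum_def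
  by (auto intro!: derivative_eq_intros simp: algebra_simps power2_eq_square)

lemma nussbaum_energy_bounded:
  obtains B where "\<And>s. \<bar>s\<bar> \<le> R \<Longrightarrow> nussbaum_energy b s \<le> B"
proof -
  have "continuous_on {-R..R} (nussbaum_energy b)"
    by (rule DERIV_continuous_on, rule has_field_derivative_at_within, rule nussbaum_energy_deriv)
  then have "bounded (nussbaum_energy b ` {-R..R})"
    using compact_continuous_image compact_imp_bounded by blast
  then obtain B where B: "\<And>s. s \<in> {-R..R} \<Longrightarrow> \<bar>nussbaum_energy b s\<bar> \<le> B"
    unfolding bounded_iff by fastforce
  have "nussbaum_energy b s \<le> B" if "\<bar>s\<bar> \<le> R" for s
    using B[of s] that by (auto simp: abs_le_iff)
  then show thesis by (rule that)
qed

text \<open>This is where the unknown sign of \<open>b\<close> is overcome. At the zeros \<open>\<kappa>\<close> of the sine at which \<open>cos \<kappa>\<close> has the sign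
of \<open>b\<close>, the leading term of the antiderivative is \<open>- \<bar>b\<bar> \<kappa>\<^sup>2\<close>, which beats every constant once \<open>\<kappa>\<close> is large,
and the same holds at \<open>- \<kappa>\<close>. An adaptive gain along which \<open>C + nussbaum_energy b k\<close> stays nonnegative
can cross neither point.\<close>

lemma nussbaum_barrier:
  fixes b C R :: real
  assumes b: "b \<noteq> 0"
  obtains \<kappa> where "R < \<kappa>" "C + nussbaum_energy b \<kappa> < 0" "C + nussbaum_energy b (- \<kappa>) < 0"
proof -
  define D where "D = \<bar>C\<bar> + 2 * \<bar>b\<bar> + 1"
  have D: "1 \<le> D" "0 \<le> D" by (auto simp: D_def)
  \<comment> \<open>An even multiple of \<open>\<pi>\<close> if \<open>b > 0\<close>, an odd one if \<open>b < 0\<close>.\<close>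
  obtain \<kappa> where \<kappa>: "\<bar>R\<bar> + 1 + D / \<bar>b\<bar> < \<kappa>" "sin \<kappa> = 0" "b * cos \<kappa> = \<bar>b\<bar>"
  proof -
    obtain n :: nat where n: "\<bar>R\<bar> + 1 + D / \<bar>b\<bar> < real n"
      using reals_Archimedean2 by blast
    have "1 * real n \<le> (2 * pi) * real n"
      using pi_ge_two by (intro mult_right_mono) auto
    then have n': "real n \<le> 2 * pi * real n" by simp
    have sc: "sin (2 * pi * real n) = 0" "cos (2 * pi * real n) = 1"
      using sin_2npi[of n] cos_2npi[of n] by (simp_all add: mult_ac)
    show ?thesis
    proof (cases "b > 0")
      case True
      then show ?thesis using that[of "2 * pi * real n"] n n' sc by auto
    next
      case False
      have "\<bar>R\<bar> + 1 + D / \<bar>b\<bar> < 2 * pi * real n + pi" using n n' pi_gt_zero by linarith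
      then show ?thesis using that[of "2 * pi * real n + pi"] sc False b by simp
    qed
  qed
  have bk: "D \<le> \<bar>b\<bar> * \<kappa>"
  proof -
    have "D / \<bar>b\<bar> \<le> \<kappa>" using \<kappa>(1) by linarith
    then show ?thesis using b by (simp add: pos_divide_le_eq mult.commute)
  qed
  have "0 \<le> D / \<bar>b\<bar>" using D by simp
  then have k1: "1 < \<kappa>" "R < \<kappa>" using \<kappa>(1) by linarith+
  have "D * \<kappa> \<le> (\<bar>b\<bar> * \<kappa>) * \<kappa>" using bk k1 by (intro mult_right_mono) auto
  moreover have "(\<bar>C\<bar> + 2 * \<bar>b\<bar>) * 1 < (\<bar>C\<bar> + 2 * \<bar>b\<bar>) * \<kappa>"
    using k1 b by (intro mult_strict_left_mono) auto
  ultimately have quad: "\<bar>C\<bar> + 2 * \<bar>b\<bar> + \<kappa> < \<bar>b\<bar> * \<kappa>\<^sup>2"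
    by (simp add: D_def power2_eq_square algebra_simps)
  have E: "nussbaum_energy b \<kappa> = \<bar>b\<bar> * (2 - \<kappa>\<^sup>2) + \<kappa>"
    "nussbaum_energy b (- \<kappa>) = \<bar>b\<bar> * (2 - \<kappa>\<^sup>2) - \<kappa>"
    using \<kappa>(2) by (simp_all add: nussbaum_energy_def \<kappa>(3)[symmetric] algebra_simps)
  show thesis
  proof (rule that[OF k1(2)])
    show "C + nussbaum_energy b \<kappa> < 0" "C + nussbaum_energy b (- \<kappa>) < 0"
      unfolding E using quad k1(1) abs_ge_self[of C] by (simp_all add: right_diff_distrib)
  qed
qed

section \<open>The adaptive loop of a single player\<close>

text \<open>The equations of one player, with the reference \<open>y\<close> and its velocity \<open>y'\<close> as external signals. The set \<open>S\<close>
of times at which they hold is a parameter because the a priori bound is applied to solutions that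
are known to satisfy the equations only up to some time.\<close>

definition player_loop ::
  "real \<Rightarrow> real \<Rightarrow> (real \<Rightarrow> real) \<Rightarrow> (real \<Rightarrow> real) \<Rightarrow> (real \<Rightarrow> real) \<Rightarrow> real set \<Rightarrow>
   (real \<Rightarrow> real) \<Rightarrow> (real \<Rightarrow> real) \<Rightarrow> (real \<Rightarrow> real) \<Rightarrow> (real \<Rightarrow> real) \<Rightarrow> bool" where
  "player_loop b \<theta> \<phi> y y' S x v k h \<longleftrightarrow> (\<forall>t\<in>S.
     let e = x t - y t + v t; w = e + \<phi> (x t) * h t + (v t - y' t)
     in (x has_real_derivative v t) (at t within {0..}) \<and>
        (v has_real_derivative b * (nussbaum (k t) * w) + \<phi> (x t) * \<theta>) (at t within {0..}) \<and>
        (k has_real_derivative e * w) (at t within {0..}) \<and>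
        (h has_real_derivative \<phi> (x t) * e) (at t within {0..}))"

text \<open>The control law is designed for this cancellation. With the tracking error \<open>e = x - y + v\<close> and
\<open>V = (e\<^sup>2 + (\<theta> - h)\<^sup>2) / 2\<close>, the parameter update removes the unknown \<open>\<theta>\<close> from \<open>V'\<close>, and what is left is
\<open>V' = (b N(k) + 1) k' - e\<^sup>2\<close>. The first summand is an exact derivative, so \<open>nussbaum_energy b k - V\<close> is a
primitive of \<open>e\<^sup>2\<close>.\<close>

lemma player_energy_deriv:
  assumes loop: "player_loop b \<theta> \<phi> y y' S x v k h" and t: "t \<in> S"
    and y: "(y has_real_derivative y' t) (at t within {0..})"
  shows "((\<lambda>t. nussbaum_energy b (k t) - ((x t - y t + v t)\<^sup>2 + (\<theta> - h t)\<^sup>2) / 2)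
    has_real_derivative (x t - y t + v t)\<^sup>2) (at t within {0..})"
proof -
  define e where "e = x t - y t + v t"
  define w where "w = e + \<phi> (x t) * h t + (v t - y' t)"
  have x: "(x has_real_derivative v t) (at t within {0..})"
    and v: "(v has_real_derivative b * (nussbaum (k t) * w) + \<phi> (x t) * \<theta>) (at t within {0..})"
    and k: "(k has_real_derivative e * w) (at t within {0..})"
    and h: "(h has_real_derivative \<phi> (x t) * e) (at t within {0..})"
    using loop t by (auto simp: player_loop_def Let_def e_def w_def)
  have "((\<lambda>t. nussbaum_energy b (k t)) has_real_derivative
      (b * nussbaum (k t) + 1) * (e * w)) (at t within {0..})"
    by (rule DERIV_chain2[OF nussbaum_energy_deriv k])
  moreover have "((\<lambda>t. ((x t - y t + v t)\<^sup>2 + (\<theta> - h t)\<^sup>2) / 2) has_real_derivative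
      e * (v t - y' t + (b * (nussbaum (k t) * w) + \<phi> (x t) * \<theta>))
        - (\<theta> - h t) * (\<phi> (x t) * e)) (at t within {0..})"
    by (rule derivative_eq_intros x v h y refl | simp)+ (simp add: e_def)
  ultimately have "((\<lambda>t. nussbaum_energy b (k t) - ((x t - y t + v t)\<^sup>2 + (\<theta> - h t)\<^sup>2) / 2)
      has_real_derivative (b * nussbaum (k t) + 1) * (e * w)
        - (e * (v t - y' t + (b * (nussbaum (k t) * w) + \<phi> (x t) * \<theta>))
           - (\<theta> - h t) * (\<phi> (x t) * e))) (at t within {0..})"
    by (rule DERIV_diff)
  also have "(b * nussbaum (k t) + 1) * (e * w)
        - (e * (v t - y' t + (b * (nussbaum (k t) * w) + \<phi> (x t) * \<theta>))
           - (\<theta> - h t) * (\<phi> (x t) * e)) = e\<^sup>2"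
    unfolding w_def by (simp add: algebra_simps power2_eq_square)
  finally show ?thesis by (simp add: e_def)
qed

text \<open>By the energy identity, \<open>V \<le> C + nussbaum_energy b k\<close> with a constant \<open>C\<close> given by the initial state. As
\<open>V \<ge> 0\<close>, the gain \<open>k\<close> is confined between two barriers; then \<open>V\<close> is bounded, hence so are \<open>e\<close> and \<open>h\<close>, and
\<open>x' = - x + (e + y)\<close> bounds \<open>x\<close> and \<open>v\<close>. The bound \<open>R\<close> does not depend on the length \<open>T\<close> of the time interval,
which is what makes it usable for the construction of global solutions.\<close>

lemma player_apriori_bound:
  fixes y y' :: "real \<Rightarrow> real" and x0 v0 k0 h0 :: real
  assumes b: "b \<noteq> 0"
    and y: "\<And>t. 0 \<le> t \<Longrightarrow> (y has_real_derivative y' t) (at t within {0..})"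
    and y_bound: "\<And>t. 0 \<le> t \<Longrightarrow> \<bar>y t\<bar> \<le> M"
  obtains R where
    "\<And>T x v k h. player_loop b \<theta> \<phi> y y' {0..T} x v k h \<Longrightarrow> 0 \<le> T \<Longrightarrow>
       x 0 = x0 \<Longrightarrow> v 0 = v0 \<Longrightarrow> k 0 = k0 \<Longrightarrow> h 0 = h0 \<Longrightarrow>
       \<bar>x T\<bar> < R \<and> \<bar>v T\<bar> < R \<and> \<bar>k T\<bar> < R \<and> \<bar>h T\<bar> < R"
proof -
  define C where "C = ((x0 - y 0 + v0)\<^sup>2 + (\<theta> - h0)\<^sup>2) / 2 - nussbaum_energy b k0"
  obtain \<kappa> where \<kappa>: "\<bar>k0\<bar> < \<kappa>" "C + nussbaum_energy b \<kappa> < 0" "C + nussbaum_energy b (- \<kappa>) < 0"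
    using nussbaum_barrier[OF b] by blast
  obtain B where B: "\<And>s. \<bar>s\<bar> \<le> \<kappa> \<Longrightarrow> nussbaum_energy b s \<le> B"
    by (rule nussbaum_energy_bounded[of \<kappa> b]) (rule that)
  define Q where "Q = 2 * \<bar>C + B\<bar> + 1"
  define R where "R = \<kappa> + (\<bar>\<theta>\<bar> + Q) + (2 * (Q + M) + \<bar>x0\<bar>)"
  have M: "0 \<le> M" using y_bound[of 0] by simp
  show thesis
  proof (rule that)
    fix T x v k h
    assume loop: "player_loop b \<theta> \<phi> y y' {0..T} x v k h" and T: "0 \<le> T"
      and init: "x 0 = x0" "v 0 = v0" "k 0 = k0" "h 0 = h0"
    define e where "e t = x t - y t + v t" for t
    have energy: "((e t)\<^sup>2 + (\<theta> - h t)\<^sup>2) / 2 \<le> C + nussbaum_energy b (k t)" if t: "t \<in> {0..T}" for t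
    proof -
      have "nussbaum_energy b (k 0) - ((x 0 - y 0 + v 0)\<^sup>2 + (\<theta> - h 0)\<^sup>2) / 2
          \<le> nussbaum_energy b (k t) - ((x t - y t + v t)\<^sup>2 + (\<theta> - h t)\<^sup>2) / 2"
        using t by (intro nondecreasing_if_deriv_nonneg[of 0 t _ _ "{0..}",
              OF player_energy_deriv[OF loop _ y]]) auto
      then show ?thesis by (simp add: init C_def e_def field_simps)
    qed
    have x_der: "(x has_real_derivative v t) (at t within {0..})"
      and k_der: "\<exists>D. (k has_real_derivative D) (at t within {0..})" if "t \<in> {0..T}" for t
      using loop that by (auto simp: player_loop_def Let_def)
    have k_cont: "continuous_on {0..T} k"
      unfolding continuous_on_eq_continuous_within
    proof
      fix t assume t: "t \<in> {0..T}"
      then show "continuous (at t within {0..T}) k"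
        using k_der[OF t] DERIV_continuous continuous_within_subset[of t "{0..}" k "{0..T}"] by auto
    qed
    have k: "\<bar>k t\<bar> < \<kappa>" if t: "t \<in> {0..T}" for t
    proof (rule stays_below[OF _ _ _ t])
      show "continuous_on {0..T} (\<lambda>t. \<bar>k t\<bar>)" by (intro continuous_intros k_cont)
      show "\<bar>k 0\<bar> < \<kappa>" using \<kappa> init by simp
      fix t assume t: "t \<in> {0..T}" and "\<forall>s\<in>{0..t}. \<bar>k s\<bar> \<le> \<kappa>"
      then have "\<bar>k t\<bar> \<le> \<kappa>" by auto
      moreover have "0 \<le> C + nussbaum_energy b (k t)"
        using energy[OF t] by (rule order_trans[rotated]) simp
      then have "k t \<noteq> \<kappa>" "k t \<noteq> - \<kappa>" using \<kappa> by auto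
      ultimately show "\<bar>k t\<bar> < \<kappa>" by linarith
    qed
    have sq: "(e t)\<^sup>2 \<le> Q\<^sup>2 \<and> (\<theta> - h t)\<^sup>2 \<le> Q\<^sup>2" if t: "t \<in> {0..T}" for t
    proof -
      have "nussbaum_energy b (k t) \<le> B" using B[of "k t"] k[OF t] by simp
      then have "(e t)\<^sup>2 + (\<theta> - h t)\<^sup>2 \<le> Q" using energy[OF t] abs_ge_self[of "C + B"]
        unfolding Q_def by (simp add: field_simps)
      moreover have "Q * 1 \<le> Q * Q" by (intro mult_left_mono) (auto simp: Q_def)
      moreover have "0 \<le> (e t)\<^sup>2" "0 \<le> (\<theta> - h t)\<^sup>2" by auto
      ultimately show ?thesis unfolding power2_eq_square[of Q] by linarith
    qed
    have Q: "0 \<le> Q" by (simp add: Q_def)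
    have e: "\<bar>e t\<bar> \<le> Q" and h: "\<bar>\<theta> - h t\<bar> \<le> Q" if "t \<in> {0..T}" for t
      using sq[OF that] Q by (auto simp: abs_le_square_iff[symmetric])
    have "\<bar>x T\<bar> \<le> (Q + M) + exp (0 - T) * \<bar>x 0\<bar>"
    proof (rule stable_filter_bound[OF _ _ _ T])
      fix t assume t: "t \<in> {0..T}"
      show "(x has_real_derivative - x t + (e t + y t)) (at t within {0..})"
        using x_der[OF t] by (simp add: e_def)
      show "\<bar>e t + y t\<bar> \<le> Q + M" using e[OF t] y_bound[of t] t by auto
    qed auto
    moreover have "exp (0 - T) * \<bar>x 0\<bar> \<le> 1 * \<bar>x 0\<bar>" using T by (intro mult_right_mono) auto
    ultimately have xT: "\<bar>x T\<bar> \<le> Q + M + \<bar>x0\<bar>" using init by simp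
    have "v T = e T - x T + y T" by (simp add: e_def)
    then have vT: "\<bar>v T\<bar> \<le> 2 * (Q + M) + \<bar>x0\<bar>"
      using xT e[of T] y_bound[of T] T by auto
    have hT: "\<bar>h T\<bar> \<le> \<bar>\<theta>\<bar> + Q" using h[of T] T by auto
    have kT: "\<bar>k T\<bar> < \<kappa>" using k[of T] T by simp
    then have pos: "0 < \<kappa>" "0 \<le> \<bar>\<theta>\<bar> + Q" "Q + M + \<bar>x0\<bar> \<le> 2 * (Q + M) + \<bar>x0\<bar>"
      "0 \<le> 2 * (Q + M) + \<bar>x0\<bar>" using Q M by auto
    show "\<bar>x T\<bar> < R \<and> \<bar>v T\<bar> < R \<and> \<bar>k T\<bar> < R \<and> \<bar>h T\<bar> < R"
    proof (intro conjI)
      show "\<bar>x T\<bar> < R" unfolding R_def using xT pos by linarith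
      show "\<bar>v T\<bar> < R" unfolding R_def using vT pos by linarith
      show "\<bar>k T\<bar> < R" unfolding R_def using kT pos by linarith
      show "\<bar>h T\<bar> < R" unfolding R_def using hT pos by linarith
    qed
  qed
qed

text \<open>Time-dependent functions that are bounded and Lipschitz in the state, uniformly in time. Unlike the
Lipschitz functions, they are closed under products, so membership of the clamped vector field of a
player can be read off from its formula.\<close>

definition bounded_lipschitz :: "(real \<Rightarrow> 'a::metric_space \<Rightarrow> real) \<Rightarrow> bool" where
  "bounded_lipschitz g \<longleftrightarrow>
     (\<exists>B L. \<forall>t\<ge>0. \<forall>X Y. \<bar>g t X\<bar> \<le> B \<and> \<bar>g t X - g t Y\<bar> \<le> L * dist X Y)"

lemma bounded_lipschitzE:
  assumes "bounded_lipschitz g"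
  obtains B L where "0 \<le> L"
    "\<And>t X Y. 0 \<le> t \<Longrightarrow> \<bar>g t X\<bar> \<le> B \<and> \<bar>g t X - g t Y\<bar> \<le> L * dist X Y"
proof -
  obtain B L where g: "\<And>t X Y. 0 \<le> t \<Longrightarrow> \<bar>g t X\<bar> \<le> B \<and> \<bar>g t X - g t Y\<bar> \<le> L * dist X Y"
    using assms unfolding bounded_lipschitz_def by metis
  have "\<bar>g t X - g t Y\<bar> \<le> \<bar>L\<bar> * dist X Y" if "0 \<le> t" for t X Y
    using g[OF that, of X Y] mult_right_mono[OF abs_ge_self[of L] zero_le_dist[of X Y]] by linarith
  then show thesis using g by (intro that[of "\<bar>L\<bar>" B]) auto
qed

lemma bounded_lipschitz_time:
  assumes "\<And>t. 0 \<le> t \<Longrightarrow> \<bar>c t\<bar> \<le> M"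
  shows "bounded_lipschitz (\<lambda>t X. c t)"
  unfolding bounded_lipschitz_def
  by (rule exI[of _ M], rule exI[of _ 0]) (use assms in auto)

lemma bounded_lipschitz_const: "bounded_lipschitz (\<lambda>t X. c)"
  by (rule bounded_lipschitz_time[of _ "\<bar>c\<bar>"]) simp

lemma bounded_lipschitz_add:
  assumes "bounded_lipschitz f" "bounded_lipschitz g"
  shows "bounded_lipschitz (\<lambda>t X. f t X + g t X)"
proof -
  obtain B L B' L' where
    f: "\<And>t X Y. 0 \<le> t \<Longrightarrow> \<bar>f t X\<bar> \<le> B \<and> \<bar>f t X - f t Y\<bar> \<le> L * dist X Y" and
    g: "\<And>t X Y. 0 \<le> t \<Longrightarrow> \<bar>g t X\<bar> \<le> B' \<and> \<bar>g t X - g t Y\<bar> \<le> L' * dist X Y"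
    using assms by (elim bounded_lipschitzE) blast
  show ?thesis unfolding bounded_lipschitz_def
  proof (rule exI[of _ "B + B'"], rule exI[of _ "L + L'"], intro allI impI conjI)
    fix t :: real and X Y assume t: "0 \<le> t"
    show "\<bar>f t X + g t X\<bar> \<le> B + B'" using f[OF t, of X X] g[OF t, of X X] by linarith
    show "\<bar>f t X + g t X - (f t Y + g t Y)\<bar> \<le> (L + L') * dist X Y"
      using f[OF t, of X Y] g[OF t, of X Y] unfolding distrib_right by linarith
  qed
qed

lemma bounded_lipschitz_mult:
  assumes "bounded_lipschitz f" "bounded_lipschitz g"
  shows "bounded_lipschitz (\<lambda>t X. f t X * g t X)"
proof -
  obtain B L B' L' where
    f: "\<And>t X Y. 0 \<le> t \<Longrightarrow> \<bar>f t X\<bar> \<le> B \<and> \<bar>f t X - f t Y\<bar> \<le> L * dist X Y" and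
    g: "\<And>t X Y. 0 \<le> t \<Longrightarrow> \<bar>g t X\<bar> \<le> B' \<and> \<bar>g t X - g t Y\<bar> \<le> L' * dist X Y"
    using assms by (elim bounded_lipschitzE) blast
  show ?thesis unfolding bounded_lipschitz_def
  proof (rule exI[of _ "B * B'"], rule exI[of _ "B * L' + B' * L"], intro allI impI conjI)
    fix t :: real and X Y assume t: "0 \<le> t"
    have B: "\<bar>f t X\<bar> \<le> B" "0 \<le> B" "\<bar>g t Y\<bar> \<le> B'" "\<bar>g t X\<bar> \<le> B'" "0 \<le> B'"
      using f[OF t, of X X] g[OF t, of X X] g[OF t, of Y Y] by auto
    show "\<bar>f t X * g t X\<bar> \<le> B * B'" using B by (simp add: abs_mult mult_mono)
    have "\<bar>f t X * g t X - f t Y * g t Y\<bar> = \<bar>f t X * (g t X - g t Y) + g t Y * (f t X - f t Y)\<bar>"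
      by (simp add: algebra_simps)
    also have "\<dots> \<le> \<bar>f t X\<bar> * \<bar>g t X - g t Y\<bar> + \<bar>g t Y\<bar> * \<bar>f t X - f t Y\<bar>"
      unfolding abs_mult[symmetric] by (rule abs_triangle_ineq)
    also have "\<dots> \<le> B * (L' * dist X Y) + B' * (L * dist X Y)"
      using B f[OF t, of X Y] g[OF t, of X Y] by (intro add_mono mult_mono) auto
    finally show "\<bar>f t X * g t X - f t Y * g t Y\<bar> \<le> (B * L' + B' * L) * dist X Y"
      by (simp add: algebra_simps)
  qed
qed

lemma bounded_lipschitz_diff:
  assumes "bounded_lipschitz f" "bounded_lipschitz g"
  shows "bounded_lipschitz (\<lambda>t X. f t X - g t X)"
  using bounded_lipschitz_add[OF assms(1) bounded_lipschitz_mult[OF bounded_lipschitz_const[of "-1"] assms(2)]]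
  by simp

text \<open>Clamping a coordinate to \<open>[-R, R]\<close> turns any \<open>C\<^sup>1\<close> function of it into a bounded Lipschitz function,
because its derivative is bounded on that interval.\<close>

lemma bounded_lipschitz_clamp:
  assumes \<psi>: "\<psi> C1_differentiable_on UNIV" and R: "0 \<le> R"
    and p: "\<And>X Y. dist (p X) (p Y) \<le> dist X Y"
  shows "bounded_lipschitz (\<lambda>t X. \<psi> (clamp (- R) R (p X)))"
proof -
  obtain D where D: "\<And>s. (\<psi> has_real_derivative D s) (at s)" and D_cont: "continuous_on UNIV D"
    using \<psi> unfolding C1_differentiable_on_def has_real_derivative_iff_has_vector_derivative by blast
  have "bounded (D ` {-R..R})" "bounded (\<psi> ` {-R..R})"
    using continuous_on_subset[OF D_cont, of "{-R..R}"]
      DERIV_continuous_on[of "{-R..R}" \<psi> D, OF has_field_derivative_at_within[OF D]]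
    by (auto intro!: compact_imp_bounded compact_continuous_image)
  then obtain L B where L: "\<And>s. s \<in> {-R..R} \<Longrightarrow> \<bar>D s\<bar> \<le> L"
    and B: "\<And>s. s \<in> {-R..R} \<Longrightarrow> \<bar>\<psi> s\<bar> \<le> B"
    unfolding bounded_iff by fastforce
  have cl: "clamp (- R) R s \<in> {-R..R}" for s :: real
    using clamp_in_interval[of "-R" R s] R by simp
  have L0: "0 \<le> L" using L[of 0] R by auto
  show ?thesis unfolding bounded_lipschitz_def
  proof (rule exI[of _ B], rule exI[of _ L], intro allI impI conjI)
    fix t :: real and X Y assume t: "0 \<le> t"
    show "\<bar>\<psi> (clamp (- R) R (p X))\<bar> \<le> B" using B[OF cl] .
    have "\<bar>\<psi> (clamp (- R) R (p X)) - \<psi> (clamp (- R) R (p Y))\<bar>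
        \<le> L * \<bar>clamp (- R) R (p X) - clamp (- R) R (p Y)\<bar>"
      using field_differentiable_bound[of "{-R..R}" \<psi> D L "clamp (- R) R (p X)" "clamp (- R) R (p Y)"]
        D L cl by (simp add: has_field_derivative_at_within)
    also have "\<dots> \<le> L * dist X Y"
      using L0 dist_clamps_le_dist_args[of "-R" R "p X" "p Y"] p[of X Y]
      by (intro mult_left_mono) (auto simp: dist_real_def)
    finally show "\<bar>\<psi> (clamp (- R) R (p X)) - \<psi> (clamp (- R) R (p Y))\<bar> \<le> L * dist X Y" .
  qed
qed

lemma bounded_lipschitz_Pair4:
  assumes "bounded_lipschitz f1" "bounded_lipschitz f2" "bounded_lipschitz f3" "bounded_lipschitz f4"
  obtains B L where
    "\<And>t. 0 \<le> t \<Longrightarrow> L-lipschitz_on UNIV (\<lambda>X. (f1 t X, f2 t X, f3 t X, f4 t X))"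
    "\<And>t X. 0 \<le> t \<Longrightarrow> norm (f1 t X, f2 t X, f3 t X, f4 t X) \<le> B"
proof -
  obtain B1 L1 where L1: "0 \<le> L1"
    and f1: "\<And>t X Y. 0 \<le> t \<Longrightarrow> \<bar>f1 t X\<bar> \<le> B1 \<and> \<bar>f1 t X - f1 t Y\<bar> \<le> L1 * dist X Y"
    by (rule bounded_lipschitzE[OF assms(1)]) blast
  obtain B2 L2 where L2: "0 \<le> L2"
    and f2: "\<And>t X Y. 0 \<le> t \<Longrightarrow> \<bar>f2 t X\<bar> \<le> B2 \<and> \<bar>f2 t X - f2 t Y\<bar> \<le> L2 * dist X Y"
    by (rule bounded_lipschitzE[OF assms(2)]) blast
  obtain B3 L3 where L3: "0 \<le> L3"
    and f3: "\<And>t X Y. 0 \<le> t \<Longrightarrow> \<bar>f3 t X\<bar> \<le> B3 \<and> \<bar>f3 t X - f3 t Y\<bar> \<le> L3 * dist X Y"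
    by (rule bounded_lipschitzE[OF assms(3)]) blast
  obtain B4 L4 where L4: "0 \<le> L4"
    and f4: "\<And>t X Y. 0 \<le> t \<Longrightarrow> \<bar>f4 t X\<bar> \<le> B4 \<and> \<bar>f4 t X - f4 t Y\<bar> \<le> L4 * dist X Y"
    by (rule bounded_lipschitzE[OF assms(4)]) blast
  have pair4: "norm (a, b, c, d) \<le> \<bar>a\<bar> + \<bar>b\<bar> + \<bar>c\<bar> + \<bar>d\<bar>" for a b c d :: real
    using norm_Pair_le[of a "(b, c, d)"] norm_Pair_le[of b "(c, d)"] norm_Pair_le[of c d] by simp
  show thesis
  proof
    fix t :: real assume t: "0 \<le> t"
    show "(L1 + L2 + L3 + L4)-lipschitz_on UNIV (\<lambda>X. (f1 t X, f2 t X, f3 t X, f4 t X))"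
    proof (rule lipschitz_onI)
      fix X Y
      show "dist (f1 t X, f2 t X, f3 t X, f4 t X) (f1 t Y, f2 t Y, f3 t Y, f4 t Y)
          \<le> (L1 + L2 + L3 + L4) * dist X Y"
        unfolding dist_norm[of "(_,_)"] diff_Pair distrib_right
        using f1[OF t, of X Y] f2[OF t, of X Y] f3[OF t, of X Y] f4[OF t, of X Y]
        by (intro order_trans[OF pair4]) linarith
    qed (use L1 L2 L3 L4 in simp)
    fix X
    show "norm (f1 t X, f2 t X, f3 t X, f4 t X) \<le> B1 + B2 + B3 + B4"
      using f1[OF t, of X X] f2[OF t, of X X] f3[OF t, of X X] f4[OF t, of X X]
      by (intro order_trans[OF pair4]) linarith
  qed
qed

lemma nussbaum_C1: "nussbaum C1_differentiable_on UNIV"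
  unfolding C1_differentiable_on_def
proof (intro exI conjI ballI)
  show "(nussbaum has_vector_derivative (2 * k * sin k + k\<^sup>2 * cos k)) (at k)" for k
    unfolding nussbaum_def[abs_def] has_real_derivative_iff_has_vector_derivative[symmetric]
    by (auto intro!: derivative_eq_intros)
qed (intro continuous_intros)

text \<open>The vector field of a player is only locally Lipschitz. Clamping all states to \<open>[-R, R]\<close>, with \<open>R\<close> above the a
priori bound, gives a globally Lipschitz field with a global solution. As long as this solution stays
in the box it solves the original equations, so the a priori bound keeps it strictly inside the box,
and by the first-exit argument it never leaves.\<close>

lemma player_loop_exists:
  fixes y y' :: "real \<Rightarrow> real" and x0 v0 k0 h0 :: real
  assumes b: "b \<noteq> 0" and \<phi>: "\<phi> C1_differentiable_on UNIV"
    and y: "\<And>t. 0 \<le> t \<Longrightarrow> (y has_real_derivative y' t) (at t within {0..})"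
    and y'_cont: "continuous_on {0..} y'"
    and y_bound: "\<And>t. 0 \<le> t \<Longrightarrow> \<bar>y t\<bar> \<le> M"
    and y'_bound: "\<And>t. 0 \<le> t \<Longrightarrow> \<bar>y' t\<bar> \<le> M"
  shows "\<exists>x v k h. player_loop b \<theta> \<phi> y y' {0..} x v k h \<and> x 0 = x0 \<and> v 0 = v0 \<and> k 0 = k0 \<and> h 0 = h0"
proof -
  obtain R0 where R0:
    "\<And>T x v k h. player_loop b \<theta> \<phi> y y' {0..T} x v k h \<Longrightarrow> 0 \<le> T \<Longrightarrow>
       x 0 = x0 \<Longrightarrow> v 0 = v0 \<Longrightarrow> k 0 = k0 \<Longrightarrow> h 0 = h0 \<Longrightarrow>
       \<bar>x T\<bar> < R0 \<and> \<bar>v T\<bar> < R0 \<and> \<bar>k T\<bar> < R0 \<and> \<bar>h T\<bar> < R0"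
    by (rule player_apriori_bound[OF b y y_bound]) (assumption, assumption, rule that)
  define R where "R = \<bar>R0\<bar> + \<bar>x0\<bar> + \<bar>v0\<bar> + \<bar>k0\<bar> + \<bar>h0\<bar> + 1"
  have R: "0 \<le> R" "R0 \<le> R" "\<bar>x0\<bar> < R" "\<bar>v0\<bar> < R" "\<bar>k0\<bar> < R" "\<bar>h0\<bar> < R" by (auto simp: R_def)
  define cl where "cl s = clamp (- R) R s" for s :: real
  have cl_id: "cl s = s" if "\<bar>s\<bar> \<le> R" for s
    using clamp_cancel_cbox[of s "-R" R] that by (auto simp: cl_def abs_le_iff)
  define px where "px X = cl (fst X)" for X :: "real \<times> real \<times> real \<times> real"
  define pv where "pv X = cl (fst (snd X))" for X :: "real \<times> real \<times> real \<times> real"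
  define pk where "pk X = cl (fst (snd (snd X)))" for X :: "real \<times> real \<times> real \<times> real"
  define ph where "ph X = cl (snd (snd (snd X)))" for X :: "real \<times> real \<times> real \<times> real"
  define e where "e t X = px X - y t + pv X" for t X
  define w where "w t X = e t X + \<phi> (px X) * ph X + (pv X - y' t)" for t X
  have proj: "dist (fst X) (fst Y) \<le> dist X Y" "dist (fst (snd X)) (fst (snd Y)) \<le> dist X Y"
    "dist (fst (snd (snd X))) (fst (snd (snd Y))) \<le> dist X Y"
    "dist (snd (snd (snd X))) (snd (snd (snd Y))) \<le> dist X Y"
    for X Y :: "real \<times> real \<times> real \<times> real"
    by (meson dist_fst_le dist_snd_le order_trans)+
  have id_C1: "(\<lambda>s. s) C1_differentiable_on (UNIV :: real set)" by simp
  note clamps = bounded_lipschitz_clamp[OF _ R(1) proj(1)] bounded_lipschitz_clamp[OF _ R(1) proj(2)]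
    bounded_lipschitz_clamp[OF _ R(1) proj(3)] bounded_lipschitz_clamp[OF _ R(1) proj(4)]
  have bl: "bounded_lipschitz (\<lambda>t X. px X)" "bounded_lipschitz (\<lambda>t X. pv X)"
    "bounded_lipschitz (\<lambda>t X. pk X)" "bounded_lipschitz (\<lambda>t X. ph X)"
    unfolding px_def pv_def pk_def ph_def cl_def by (rule clamps[OF id_C1])+
  have bl2: "bounded_lipschitz (\<lambda>t X. \<phi> (px X))" "bounded_lipschitz (\<lambda>t X. nussbaum (pk X))"
    unfolding px_def pk_def cl_def by (rule clamps \<phi> nussbaum_C1)+
  note bl_rules = bl bl2 bounded_lipschitz_add bounded_lipschitz_diff bounded_lipschitz_mult
    bounded_lipschitz_const bounded_lipschitz_time[of y M, OF y_bound]
    bounded_lipschitz_time[of y' M, OF y'_bound]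
  have bl_e: "bounded_lipschitz e" unfolding e_def[abs_def] by (intro bl_rules)
  have bl_w: "bounded_lipschitz w" unfolding w_def[abs_def] by (intro bl_rules bl_e[unfolded e_def[abs_def]] bl_e)
  define F where "F t X = (pv X, b * (nussbaum (pk X) * w t X) + \<phi> (px X) * \<theta>,
    e t X * w t X, \<phi> (px X) * e t X)" for t X
  obtain B L where lip: "\<And>t. 0 \<le> t \<Longrightarrow> L-lipschitz_on UNIV (F t)"
    and bdd: "\<And>t X. 0 \<le> t \<Longrightarrow> norm (F t X) \<le> B"
  proof (rule bounded_lipschitz_Pair4)
    show "bounded_lipschitz (\<lambda>t X. pv X)"
      "bounded_lipschitz (\<lambda>t X. b * (nussbaum (pk X) * w t X) + \<phi> (px X) * \<theta>)"
      "bounded_lipschitz (\<lambda>t X. e t X * w t X)" "bounded_lipschitz (\<lambda>t X. \<phi> (px X) * e t X)"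
      by (intro bl_rules bl_e bl_w)+
  qed (auto simp: F_def[abs_def])
  have y_cont: "continuous_on {0..} y" using y by (intro DERIV_continuous_on) auto
  have cont: "continuous_on {0..} (\<lambda>t. F t X)" for X
    unfolding F_def w_def e_def by (intro continuous_intros y_cont y'_cont)
  obtain X where X0: "X 0 = (x0, v0, k0, h0)"
    and X: "\<And>t. 0 \<le> t \<Longrightarrow> (X has_vector_derivative F t (X t)) (at t within {0..})"
    by (rule global_solution_of_lipschitz_field[OF lip cont bdd]) (assumption, assumption, rule that)
  define x where "x t = fst (X t)" for t
  define v where "v t = fst (snd (X t))" for t
  define k where "k t = fst (snd (snd (X t)))" for t
  define h where "h t = snd (snd (snd (X t)))" for t
  have ders: "(x has_real_derivative fst (F t (X t))) (at t within {0..})"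
    "(v has_real_derivative fst (snd (F t (X t)))) (at t within {0..})"
    "(k has_real_derivative fst (snd (snd (F t (X t))))) (at t within {0..})"
    "(h has_real_derivative snd (snd (snd (F t (X t))))) (at t within {0..})" if "0 \<le> t" for t
    unfolding x_def v_def k_def h_def has_real_derivative_iff_has_vector_derivative
    by (intro bounded_linear.has_vector_derivative[OF bounded_linear_fst]
        bounded_linear.has_vector_derivative[OF bounded_linear_snd] X[OF that])+
  have init: "x 0 = x0" "v 0 = v0" "k 0 = k0" "h 0 = h0"
    using X0 by (simp_all add: x_def v_def k_def h_def)
  define g where "g t = max (max \<bar>x t\<bar> \<bar>v t\<bar>) (max \<bar>k t\<bar> \<bar>h t\<bar>)" for t
  have loop: "player_loop b \<theta> \<phi> y y' S x v k h" if S: "S \<subseteq> {0..}" and g: "\<And>t. t \<in> S \<Longrightarrow> g t \<le> R" for S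
    unfolding player_loop_def Let_def
  proof
    fix t assume t: "t \<in> S"
    then have t0: "0 \<le> t" using S by auto
    have id: "px (X t) = x t" "pv (X t) = v t" "pk (X t) = k t" "ph (X t) = h t"
      using g[OF t] by (simp_all add: px_def pv_def pk_def ph_def cl_id g_def x_def v_def k_def h_def)
    show "(x has_real_derivative v t) (at t within {0..}) \<and>
      (v has_real_derivative b * (nussbaum (k t) * (x t - y t + v t + \<phi> (x t) * h t + (v t - y' t)))
         + \<phi> (x t) * \<theta>) (at t within {0..}) \<and>
      (k has_real_derivative (x t - y t + v t) * (x t - y t + v t + \<phi> (x t) * h t + (v t - y' t)))
         (at t within {0..}) \<and>
      (h has_real_derivative \<phi> (x t) * (x t - y t + v t)) (at t within {0..})"
      using ders[OF t0] by (simp add: F_def w_def e_def id)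
  qed
  have g_cont: "continuous_on {0..} g"
  proof -
    have "continuous_on {0..} x" "continuous_on {0..} v" "continuous_on {0..} k" "continuous_on {0..} h"
      by (rule DERIV_continuous_on, rule ders, simp)+
    then show ?thesis unfolding g_def by (intro continuous_intros)
  qed
  have g: "g t < R" if t: "0 \<le> t" for t
  proof (rule stays_below[where g = g and T = t and t = t])
    show "continuous_on {0..t} g" by (rule continuous_on_subset[OF g_cont]) auto
    show "g 0 < R" using R by (simp add: g_def init)
    fix s assume s: "s \<in> {0..t}" and "\<forall>u\<in>{0..s}. g u \<le> R"
    then have "player_loop b \<theta> \<phi> y y' {0..s} x v k h" by (intro loop) auto
    then have "\<bar>x s\<bar> < R0 \<and> \<bar>v s\<bar> < R0 \<and> \<bar>k s\<bar> < R0 \<and> \<bar>h s\<bar> < R0"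
      using s init by (intro R0) auto
    then show "g s < R" using R(2) by (simp add: g_def)
  qed (use t in simp)
  have "player_loop b \<theta> \<phi> y y' {0..} x v k h" using g by (intro loop) (auto intro: less_imp_le)
  then show ?thesis using init by blast
qed

text \<open>The states are bounded, so \<open>e\<^sup>2\<close> has a bounded primitive by the energy identity and a bounded derivative by
the equations; Barbalat's lemma gives \<open>e \<longlongrightarrow> 0\<close>. The difference \<open>x - y\<close> obeys
\<open>(x - y)' = - (x - y) + (e - y')\<close>, whose input tends to zero.\<close>

lemma player_loop_converges:
  fixes y y' :: "real \<Rightarrow> real"
  assumes b: "b \<noteq> 0" and \<phi>: "continuous_on UNIV \<phi>"
    and loop: "player_loop b \<theta> \<phi> y y' {0..} x v k h"
    and y: "\<And>t. 0 \<le> t \<Longrightarrow> (y has_real_derivative y' t) (at t within {0..})"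
    and y_bound: "\<And>t. 0 \<le> t \<Longrightarrow> \<bar>y t\<bar> \<le> M"
    and y'_bound: "\<And>t. 0 \<le> t \<Longrightarrow> \<bar>y' t\<bar> \<le> M"
    and y'_lim: "(y' \<longlongrightarrow> 0) at_top"
  shows "((\<lambda>t. x t - y t) \<longlongrightarrow> 0) at_top" "bounded (k ` {0..})" "bounded (h ` {0..})"
proof -
  obtain R where R:
    "\<And>T x' v' k' h'. player_loop b \<theta> \<phi> y y' {0..T} x' v' k' h' \<Longrightarrow> 0 \<le> T \<Longrightarrow>
       x' 0 = x 0 \<Longrightarrow> v' 0 = v 0 \<Longrightarrow> k' 0 = k 0 \<Longrightarrow> h' 0 = h 0 \<Longrightarrow>
       \<bar>x' T\<bar> < R \<and> \<bar>v' T\<bar> < R \<and> \<bar>k' T\<bar> < R \<and> \<bar>h' T\<bar> < R"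
    by (rule player_apriori_bound[OF b y y_bound]) (assumption, assumption, rule that)
  have bnd: "\<bar>x t\<bar> < R \<and> \<bar>v t\<bar> < R \<and> \<bar>k t\<bar> < R \<and> \<bar>h t\<bar> < R" if "0 \<le> t" for t
    by (rule R[OF _ that]) (use loop in \<open>auto simp: player_loop_def\<close>)
  show "bounded (k ` {0..})" "bounded (h ` {0..})"
    using bnd by (auto simp: bounded_iff intro!: exI[of _ R] less_imp_le)
  define e where "e t = x t - y t + v t" for t
  define w where "w t = e t + \<phi> (x t) * h t + (v t - y' t)" for t
  have x_der: "(x has_real_derivative v t) (at t within {0..})"
    and v_der: "(v has_real_derivative b * (nussbaum (k t) * w t) + \<phi> (x t) * \<theta>) (at t within {0..})"
    if "0 \<le> t" for t
    using loop that by (auto simp: player_loop_def Let_def e_def w_def)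
  \<comment> \<open>The derivative of \<open>e\<^sup>2\<close> as a continuous function of the states and the external signals,
    which range over a compact box; this yields its bound.\<close>
  define G where "G p = (case p of (x, v, k, h, y, y') \<Rightarrow> 2 * (x - y + v) *
    (v - y' + (b * (nussbaum k * (x - y + v + \<phi> x * h + (v - y'))) + \<phi> x * \<theta>)))"
    for p :: "real \<times> real \<times> real \<times> real \<times> real \<times> real"
  define Box where "Box = {-R..R} \<times> {-R..R} \<times> {-R..R} \<times> {-R..R} \<times> {-M..M} \<times> {-M..M}"
  have "continuous_on UNIV G"
    unfolding G_def nussbaum_def case_prod_beta
    by (intro continuous_intros continuous_on_compose2[OF \<phi>]) auto
  then have "bounded (G ` Box)"
    by (intro compact_imp_bounded compact_continuous_image)
      (auto simp: Box_def intro: continuous_on_subset intro!: compact_Times)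
  then obtain K where K: "\<And>p. p \<in> Box \<Longrightarrow> \<bar>G p\<bar> \<le> K"
    unfolding bounded_iff by fastforce
  have e_der: "(e has_real_derivative v t - y' t + (b * (nussbaum (k t) * w t) + \<phi> (x t) * \<theta>))
      (at t within {0..})" if "0 \<le> t" for t
    unfolding e_def by (auto intro!: derivative_eq_intros x_der v_der y that)
  have energy: "((\<lambda>t. nussbaum_energy b (k t) - ((e t)\<^sup>2 + (\<theta> - h t)\<^sup>2) / 2)
      has_real_derivative (e t)\<^sup>2) (at t within {0..})" if "0 \<le> t" for t
    unfolding e_def using that by (intro player_energy_deriv[OF loop _ y]) auto
  obtain B where B: "\<And>s. \<bar>s\<bar> \<le> R \<Longrightarrow> nussbaum_energy b s \<le> B"
    by (rule nussbaum_energy_bounded[of R b]) (rule that)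
  have "((\<lambda>t. (e t)\<^sup>2) \<longlongrightarrow> 0) at_top"
  proof (rule barbalat[OF energy])
    fix t :: real assume t: "0 \<le> t"
    let ?p = "(x t, v t, k t, h t, y t, y' t)"
    show "((\<lambda>t. (e t)\<^sup>2) has_real_derivative G ?p) (at t within {0..})"
      by (rule derivative_eq_intros e_der[OF t] refl)+ (simp add: G_def e_def w_def)
    have "?p \<in> Box" using bnd[OF t] y_bound[OF t] y'_bound[OF t] by (auto simp: Box_def abs_less_iff abs_le_iff)
    then show "\<bar>G ?p\<bar> \<le> K" by (rule K)
    have "nussbaum_energy b (k t) \<le> B" using B[of "k t"] bnd[OF t] by simp
    moreover have "0 \<le> ((e t)\<^sup>2 + (\<theta> - h t)\<^sup>2) / 2" by simp
    ultimately show "nussbaum_energy b (k t) - ((e t)\<^sup>2 + (\<theta> - h t)\<^sup>2) / 2 \<le> B" by linarith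
  qed auto
  then have e_lim: "(e \<longlongrightarrow> 0) at_top" by (simp add: power_tendsto_0_iff)
  show "((\<lambda>t. x t - y t) \<longlongrightarrow> 0) at_top"
  proof (rule stable_filter_tendsto_0)
    show "((\<lambda>t. x t - y t) has_real_derivative - (x t - y t) + (e t - y' t)) (at t within {0..})"
      if "0 \<le> t" for t
      by (rule derivative_eq_intros x_der[OF that] y[OF that] refl)+ (simp add: e_def)
    show "((\<lambda>t. e t - y' t) \<longlongrightarrow> 0) at_top" using tendsto_diff[OF e_lim y'_lim] by simp
  qed
qed

section \<open>The Nash equilibrium\<close>

lemma partial_has_derivative:
  assumes "Ck (Suc n) g"
  shows "((\<lambda>s. g (replace x i s)) has_real_derivative partial i g (replace x i s)) (at s)"
proof -
  have r: "replace (replace x i s) i = replace x i" "replace x i s $ i = s"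
    by (auto simp: replace_def fun_eq_iff vec_eq_iff)
  have "(\<lambda>s'. g (replace (replace x i s) i s')) differentiable (at (replace x i s $ i))"
    using assms by simp
  then show ?thesis
    by (simp add: r partial_def DERIV_deriv_iff_real_differentiable)
qed

text \<open>Monotonicity of the pseudogradient, applied to two profiles that differ in the action of player \<open>i\<close> only,
says that the partial derivative of \<open>f i\<close> in its own action is nondecreasing. Each cost is thus convex in
the own action, and its critical points are its minimisers.\<close>

lemma nash_equilibrium_iff:
  fixes f :: "'n::finite \<Rightarrow> real ^ 'n \<Rightarrow> real"
  assumes smooth: "\<And>i. Ck (Suc n) (f i)" and m: "0 \<le> m"
    and mono: "\<And>x z. m * (norm (x - z))\<^sup>2 \<le> (x - z) \<bullet> (pseudogradient f x - pseudogradient f z)"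
  shows "nash_equilibrium f xs \<longleftrightarrow> pseudogradient f xs = 0"
proof -
  define g where "g i s = f i (replace xs i s)" for i s
  define g' where "g' i s = partial i (f i) (replace xs i s)" for i s
  have der: "(g i has_real_derivative g' i s) (at s)" for i s
    unfolding g_def g'_def by (rule partial_has_derivative[OF smooth])
  have same: "replace xs i (xs $ i) = xs" for i by (simp add: replace_def vec_eq_iff)
  have g'_mono: "0 \<le> (s - u) * (g' i s - g' i u)" for i s u
  proof -
    let ?x = "replace xs i s" and ?z = "replace xs i u"
    have "?x - ?z = axis i (s - u)" by (auto simp: replace_def vec_eq_iff axis_def)
    then have "(?x - ?z) \<bullet> (pseudogradient f ?x - pseudogradient f ?z) = (s - u) * (g' i s - g' i u)"
      by (simp add: inner_axis' pseudogradient_def g'_def)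
    moreover have "0 \<le> m * (norm (?x - ?z))\<^sup>2" using m by simp
    ultimately show ?thesis using mono[of ?x ?z] by linarith
  qed
  show ?thesis
  proof
    assume nash: "nash_equilibrium f xs"
    have "g' i (xs $ i) = 0" for i
      by (rule DERIV_local_min[OF der zero_less_one])
        (use nash in \<open>auto simp: nash_equilibrium_def g_def same\<close>)
    then show "pseudogradient f xs = 0"
      by (simp add: pseudogradient_def vec_eq_iff g'_def same)
  next
    assume "pseudogradient f xs = 0"
    then have crit: "g' i (xs $ i) = 0" for i
      by (simp add: pseudogradient_def vec_eq_iff g'_def same)
    have "g i (xs $ i) \<le> g i s" for i s
    proof (cases "xs $ i \<le> s")
      case True
      show ?thesis
      proof (rule DERIV_nonneg_imp_nondecreasing[OF True])
        fix u assume u: "xs $ i \<le> u" "u \<le> s"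
        then have "0 \<le> g' i u"
          using g'_mono[of u "xs $ i" i] crit[of i] by (cases "u = xs $ i") (auto simp: zero_le_mult_iff)
        then show "\<exists>D. (g i has_real_derivative D) (at u) \<and> 0 \<le> D" using der by blast
      qed
    next
      case False
      then have le: "s \<le> xs $ i" by simp
      show ?thesis
      proof (rule DERIV_nonpos_imp_nonincreasing[OF le])
        fix u assume u: "s \<le> u" "u \<le> xs $ i"
        then have "g' i u \<le> 0"
          using g'_mono[of u "xs $ i" i] crit[of i] by (cases "u = xs $ i") (auto simp: zero_le_mult_iff)
        then show "\<exists>D. (g i has_real_derivative D) (at u) \<and> D \<le> 0" using der by blast
      qed
    qed
    then show "nash_equilibrium f xs" by (simp add: nash_equilibrium_def g_def same)
  qed
qed

text \<open>For a small step \<open>\<alpha>\<close> the gradient step \<open>x - \<alpha> P x\<close> is a contraction: expanding the square,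
\<open>\<bar>d - \<alpha> (P x - P z)\<bar>\<^sup>2 \<le> (1 - 2 \<alpha> m + \<alpha>\<^sup>2 K\<^sup>2) \<bar>d\<bar>\<^sup>2\<close> with \<open>d = x - z\<close> and a
Lipschitz constant \<open>K\<close> of \<open>P\<close>. Its fixed point is a zero of \<open>P\<close>.\<close>

lemma strongly_monotone_has_zero:
  fixes P :: "'a::{real_inner,banach} \<Rightarrow> 'a"
  assumes lip: "L-lipschitz_on UNIV P" and m: "0 < m"
    and mono: "\<And>x z. m * (norm (x - z))\<^sup>2 \<le> (x - z) \<bullet> (P x - P z)"
  obtains x where "P x = 0"
proof -
  have L: "0 \<le> L" using lip by (rule lipschitz_on_nonneg)
  \<comment> \<open>Enlarged to be at least \<open>m\<close>, so that \<open>\<alpha> m \<le> 1\<close> for the optimal step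
    \<open>\<alpha> = m / K\<^sup>2\<close>, and positive even if \<open>L = 0\<close>.\<close>
  define K where "K = L + m"
  have K: "0 < K" "L \<le> K" "m \<le> K" using L m by (auto simp: K_def)
  define \<alpha> where "\<alpha> = m / K\<^sup>2"
  have \<alpha>: "0 < \<alpha>" "\<alpha> * K\<^sup>2 = m" using m K by (auto simp: \<alpha>_def)
  define c where "c = sqrt (1 - \<alpha> * m)"
  have "m * m \<le> K * K" using K m by (intro mult_mono) auto
  then have am: "\<alpha> * m \<le> 1" "0 < \<alpha> * m"
    using K(1) m by (simp_all add: \<alpha>_def power2_eq_square)
  have "dist (x - \<alpha> *\<^sub>R P x) (z - \<alpha> *\<^sub>R P z) \<le> c * dist x z" for x z
  proof -
    let ?d = "x - z" and ?P = "P x - P z"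
    have "norm ?P \<le> K * norm ?d"
      using lipschitz_on_normD[OF lip, of x z] mult_right_mono[OF K(2) norm_ge_zero[of ?d]] by simp
    then have "(norm ?P)\<^sup>2 \<le> (K * norm ?d)\<^sup>2" by (intro power_mono) auto
    then have "\<alpha>\<^sup>2 * (norm ?P)\<^sup>2 \<le> \<alpha>\<^sup>2 * (K * norm ?d)\<^sup>2" by (intro mult_left_mono) auto
    also have "\<dots> = \<alpha> * (\<alpha> * K\<^sup>2) * (norm ?d)\<^sup>2" by (simp add: power2_eq_square)
    finally have 1: "\<alpha>\<^sup>2 * (norm ?P)\<^sup>2 \<le> \<alpha> * m * (norm ?d)\<^sup>2" by (simp add: \<alpha>)
    have 2: "\<alpha> * (m * (norm ?d)\<^sup>2) \<le> \<alpha> * (?d \<bullet> ?P)"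
      using mono \<alpha> by (intro mult_left_mono) auto
    have "(norm (?d - \<alpha> *\<^sub>R ?P))\<^sup>2 = (norm ?d)\<^sup>2 - 2 * (\<alpha> * (?d \<bullet> ?P)) + \<alpha>\<^sup>2 * (norm ?P)\<^sup>2"
      unfolding power2_norm_eq_inner
      by (simp add: inner_diff inner_commute power2_eq_square algebra_simps)
    also have "\<dots> \<le> (1 - \<alpha> * m) * (norm ?d)\<^sup>2" using 1 2 by (simp add: algebra_simps)
    also have "\<dots> = (c * norm ?d)\<^sup>2" using am by (simp add: c_def power_mult_distrib)
    finally have "norm (?d - \<alpha> *\<^sub>R ?P) \<le> c * norm ?d"
      by (rule power2_le_imp_le) (use am in \<open>simp add: c_def\<close>)
    moreover have "x - \<alpha> *\<^sub>R P x - (z - \<alpha> *\<^sub>R P z) = ?d - \<alpha> *\<^sub>R ?P"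
      by (simp add: scaleR_diff_right)
    ultimately show ?thesis by (simp only: dist_norm)
  qed
  then have "\<exists>!x. x - \<alpha> *\<^sub>R P x = x"
    using am by (intro banach_fix_type[of c]) (auto simp: c_def)
  then obtain x where "x - \<alpha> *\<^sub>R P x = x" by blast
  then have "\<alpha> *\<^sub>R P x = 0" by (simp only: diff_eq_eq add_cancel_right_right)
  then show thesis using that[of x] \<alpha>(1) by simp
qed

lemma lipschitz_on_vec:
  fixes g :: "'a::metric_space \<Rightarrow> 'b::real_normed_vector ^ 'n"
  assumes "\<And>i. (l i)-lipschitz_on S (\<lambda>x. g x $ i)"
  shows "(\<Sum>i\<in>UNIV. l i)-lipschitz_on S g"
proof (rule lipschitz_onI)
  fix x z assume xz: "x \<in> S" "z \<in> S"
  have "dist (g x) (g z) \<le> (\<Sum>i\<in>UNIV. dist (g x $ i) (g z $ i))"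
    unfolding dist_vec_def by (rule L2_set_le_sum) simp
  also have "\<dots> \<le> (\<Sum>i\<in>UNIV. l i * dist x z)"
    using assms xz by (intro sum_mono) (auto simp: lipschitz_on_def)
  finally show "dist (g x) (g z) \<le> (\<Sum>i\<in>UNIV. l i) * dist x z" by (simp add: sum_distrib_right)
next
  show "0 \<le> (\<Sum>i\<in>UNIV. l i)" by (rule sum_nonneg) (rule lipschitz_on_nonneg[OF assms])
qed

section \<open>Consensus over a connected graph\<close>

text \<open>The quadratic form, in the estimation errors \<open>\<eta> $ i $ j\<close> of the estimates held by player \<open>i\<close> of the action
of player \<open>j\<close>, of the matrices \<open>L + diag (A $ i $ j)\<^sub>i\<close>, one for each \<open>j\<close>, where \<open>L\<close> is the graph Laplacian.\<close>

definition consensus_form :: "real ^ 'n ^ 'n \<Rightarrow> real ^ 'n ^ 'n \<Rightarrow> real" where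
  "consensus_form A \<eta> = (\<Sum>i\<in>UNIV. \<Sum>j\<in>UNIV. \<eta> $ i $ j *
     ((\<Sum>l\<in>UNIV. A $ i $ l * (\<eta> $ i $ j - \<eta> $ l $ j)) + A $ i $ j * \<eta> $ i $ j))"

lemma laplacian_form:
  fixes A :: "'n::finite \<Rightarrow> 'n \<Rightarrow> real"
  assumes sym: "\<And>i l. A i l = A l i"
  shows "(\<Sum>i\<in>UNIV. u i * (\<Sum>l\<in>UNIV. A i l * (u i - u l)))
    = (\<Sum>i\<in>UNIV. \<Sum>l\<in>UNIV. A i l * (u i - u l)\<^sup>2) / 2" (is "?S = ?T / 2")
proof -
  have S: "?S = (\<Sum>i\<in>UNIV. \<Sum>l\<in>UNIV. A i l * (u i * (u i - u l)))"
    by (simp add: sum_distrib_left mult_ac)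
  also have "\<dots> = (\<Sum>l\<in>UNIV. \<Sum>i\<in>UNIV. A i l * (u i * (u i - u l)))" by (rule sum.swap)
  also have "\<dots> = (\<Sum>i\<in>UNIV. \<Sum>l\<in>UNIV. A i l * (u l * (u l - u i)))" by (simp only: sym)
  finally have "?S + ?S = (\<Sum>i\<in>UNIV. \<Sum>l\<in>UNIV. A i l * (u i * (u i - u l)) + A i l * (u l * (u l - u i)))"
    using S by (simp add: sum.distrib)
  also have "\<dots> = ?T"
    by (intro sum.cong refl) (simp add: power2_eq_square algebra_simps)
  finally show ?thesis by simp
qed

lemma consensus_form_eq:
  fixes A :: "real ^ 'n::finite ^ 'n"
  assumes sym: "\<And>i l. A $ i $ l = A $ l $ i"
  shows "consensus_form A \<eta> = (\<Sum>j\<in>UNIV. (\<Sum>i\<in>UNIV. \<Sum>l\<in>UNIV. A $ i $ l * (\<eta> $ i $ j - \<eta> $ l $ j)\<^sup>2) / 2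
     + (\<Sum>i\<in>UNIV. A $ i $ j * (\<eta> $ i $ j)\<^sup>2))"
proof -
  have "consensus_form A \<eta> = (\<Sum>j\<in>UNIV. (\<Sum>i\<in>UNIV. \<eta> $ i $ j * (\<Sum>l\<in>UNIV. A $ i $ l * (\<eta> $ i $ j - \<eta> $ l $ j)))
     + (\<Sum>i\<in>UNIV. A $ i $ j * (\<eta> $ i $ j)\<^sup>2))"
    unfolding consensus_form_def
    by (subst sum.swap) (simp add: distrib_left sum.distrib power2_eq_square mult_ac)
  then show ?thesis by (simp only: laplacian_form[of "\<lambda>i l. A $ i $ l", OF sym])
qed

text \<open>The form is a sum of nonnegative terms. If it vanishes, then for each \<open>j\<close> the errors agree across every
edge, hence on the whole connected graph, and they are zero at a neighbour of \<open>j\<close>. Such a neighbour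
exists because there is a second player, from which a path leads to \<open>j\<close>.\<close>

lemma consensus_form_pos:
  fixes A :: "real ^ 'n::finite ^ 'n"
  assumes card: "CARD('n) \<ge> 2" and adj: "adjacency_matrix E A" and graph: "undirected_connected E A"
    and \<eta>: "\<eta> \<noteq> 0"
  shows "0 < consensus_form A \<eta>"
proof (rule ccontr)
  assume neg: "\<not> 0 < consensus_form A \<eta>"
  have sym: "A $ i $ l = A $ l $ i" for i l
    using graph unfolding undirected_connected_def by blast
  have edge: "0 < A $ q $ p" if "(p, q) \<in> E" for p q
    using adj that unfolding adjacency_matrix_def by blast
  have A_nonneg: "0 \<le> A $ q $ p" for p q
  proof (cases "(p, q) \<in> E")
    case True
    then show ?thesis using edge by (simp add: less_imp_le)
  next
    case False
    then show ?thesis using adj unfolding adjacency_matrix_def by simp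
  qed
  define U where "U j = (\<Sum>i\<in>UNIV. \<Sum>l\<in>UNIV. A $ i $ l * (\<eta> $ i $ j - \<eta> $ l $ j)\<^sup>2)" for j
  define V where "V j = (\<Sum>i\<in>UNIV. A $ i $ j * (\<eta> $ i $ j)\<^sup>2)" for j
  have nonneg: "0 \<le> U j" "0 \<le> V j" for j
    unfolding U_def V_def using A_nonneg by (intro sum_nonneg mult_nonneg_nonneg; simp)+
  have "(\<Sum>j\<in>UNIV. U j / 2 + V j) = 0"
    using neg consensus_form_eq[OF sym, of \<eta>] nonneg
    by (intro order_antisym sum_nonneg) (auto simp: U_def V_def)
  then have "U j / 2 + V j = 0" for j
    using nonneg by (subst (asm) sum_nonneg_eq_0_iff) auto
  then have UV: "U j = 0" "V j = 0" for j
    using nonneg[of j] by (metis add_nonneg_eq_0_iff divide_eq_0_iff divide_nonneg_pos zero_less_numeral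
        zero_neq_numeral)+
  have agree: "A $ i $ l * (\<eta> $ i $ j - \<eta> $ l $ j)\<^sup>2 = 0" for i l j
  proof -
    have "(\<Sum>l\<in>UNIV. A $ i $ l * (\<eta> $ i $ j - \<eta> $ l $ j)\<^sup>2) = 0"
      using UV(1)[of j] A_nonneg unfolding U_def
      by (subst (asm) sum_nonneg_eq_0_iff) (auto intro: sum_nonneg)
    then show ?thesis using A_nonneg by (subst (asm) sum_nonneg_eq_0_iff) auto
  qed
  have pinned: "A $ i $ j * (\<eta> $ i $ j)\<^sup>2 = 0" for i j
    using UV(2)[of j] A_nonneg unfolding V_def by (subst (asm) sum_nonneg_eq_0_iff) auto
  have edge_agree: "\<eta> $ p $ j = \<eta> $ q $ j" if "(p, q) \<in> E" for p q j
    using agree[of q p j] edge[OF that] by simp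
  have path_agree: "\<eta> $ p $ j = \<eta> $ q $ j" if "(p, q) \<in> E\<^sup>+" for p q j
    using that
  proof (induction rule: trancl_induct)
    case (base q)
    then show ?case by (rule edge_agree)
  next
    case (step q r)
    then show ?case using edge_agree[of q r j] by simp
  qed
  have "\<eta> $ i $ j = 0" for i j
  proof -
    obtain r where r: "r \<noteq> j"
    proof -
      have "\<not> (\<forall>r. r = j)"
      proof
        assume "\<forall>r. r = j"
        then have "(UNIV :: 'n set) = {j}" by auto
        then have "CARD('n) = card {j}" by (rule arg_cong)
        then show False using card by simp
      qed
      then show thesis using that by blast
    qed
    then have "(r, j) \<in> E\<^sup>+" using graph unfolding undirected_connected_def by blast
    then obtain p where p: "(p, j) \<in> E" by (metis tranclD2)
    have "0 < A $ p $ j" using edge[OF p] sym by simp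
    then have "\<eta> $ p $ j = 0" using pinned[of p j] by simp
    moreover have "\<eta> $ i $ j = \<eta> $ p $ j"
    proof (cases "i = p")
      case False
      then have "(i, p) \<in> E\<^sup>+" using graph unfolding undirected_connected_def by blast
      then show ?thesis by (rule path_agree)
    qed simp
    ultimately show ?thesis by simp
  qed
  then show False using \<eta> by (simp add: vec_eq_iff)
qed

text \<open>The minimum over the unit sphere is positive by compactness, and homogeneity extends the estimate.\<close>

lemma coercive_if_positive_definite:
  fixes q :: "'a::euclidean_space \<Rightarrow> real"
  assumes cont: "continuous_on UNIV q" and hom: "\<And>c x. q (c *\<^sub>R x) = c\<^sup>2 * q x"
    and pos: "\<And>x. x \<noteq> 0 \<Longrightarrow> 0 < q x"
  obtains \<mu> where "0 < \<mu>" "\<And>x. \<mu> * (norm x)\<^sup>2 \<le> q x"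
proof -
  obtain u where u: "u \<in> sphere (0::'a) 1" and least: "\<And>x. x \<in> sphere 0 1 \<Longrightarrow> q u \<le> q x"
    using continuous_attains_inf[of "sphere (0::'a) 1" q] continuous_on_subset[OF cont]
    by (auto simp del: mem_sphere_0)
  show thesis
  proof
    show "0 < q u" using u by (intro pos) auto
    fix x
    show "q u * (norm x)\<^sup>2 \<le> q x"
    proof (cases "x = 0")
      case True
      then show ?thesis using hom[of 0 0] by simp
    next
      case False
      have "q u * (norm x)\<^sup>2 \<le> q ((1 / norm x) *\<^sub>R x) * (norm x)\<^sup>2"
        using False by (intro mult_right_mono least) auto
      also have "\<dots> = q x" using False by (simp add: hom power_divide)
      finally show ?thesis .
    qed
  qed
qed

lemma consensus_form_coercive:
  fixes A :: "real ^ 'n::finite ^ 'n"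
  assumes "CARD('n) \<ge> 2" "adjacency_matrix E A" "undirected_connected E A"
  obtains \<mu> where "0 < \<mu>" "\<And>\<eta>. \<mu> * (norm \<eta>)\<^sup>2 \<le> consensus_form A \<eta>"
proof (rule coercive_if_positive_definite)
  show "continuous_on UNIV (consensus_form A)"
    unfolding consensus_form_def[abs_def] by (intro continuous_intros)
  show "consensus_form A (c *\<^sub>R \<eta>) = c\<^sup>2 * consensus_form A \<eta>" for c \<eta>
  proof -
    have "c * \<eta> $ i $ j * ((\<Sum>l\<in>UNIV. A $ i $ l * (c * \<eta> $ i $ j - c * \<eta> $ l $ j)) + A $ i $ j * (c * \<eta> $ i $ j))
      = c\<^sup>2 * (\<eta> $ i $ j * ((\<Sum>l\<in>UNIV. A $ i $ l * (\<eta> $ i $ j - \<eta> $ l $ j)) + A $ i $ j * \<eta> $ i $ j))" for i j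
    proof -
      have "(\<Sum>l\<in>UNIV. A $ i $ l * (c * \<eta> $ i $ j - c * \<eta> $ l $ j)) = c * (\<Sum>l\<in>UNIV. A $ i $ l * (\<eta> $ i $ j - \<eta> $ l $ j))"
        unfolding sum_distrib_left by (intro sum.cong refl) (simp add: algebra_simps)
      then show ?thesis by (simp add: power2_eq_square algebra_simps)
    qed
    then show ?thesis
      unfolding consensus_form_def sum_distrib_left[of "c\<^sup>2"] vector_scaleR_component real_scaleR_def
      by (intro sum.cong refl)
  qed
  show "0 < consensus_form A \<eta>" if "\<eta> \<noteq> 0" for \<eta>
    using consensus_form_pos[OF assms that] .
qed (rule that)

section \<open>Distributed Nash equilibrium seeking\<close>

text \<open>The part of the closed loop formed by the references \<open>y\<close> and the estimates \<open>z\<close>. It is autonomous: the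
plant and the adaptive gains do not enter.\<close>

definition estimation_loop ::
  "('n \<Rightarrow> real ^ 'n \<Rightarrow> real) \<Rightarrow> real ^ 'n ^ 'n \<Rightarrow> ('n \<Rightarrow> 'n \<Rightarrow> real) \<Rightarrow>
   (real \<Rightarrow> real ^ 'n) \<Rightarrow> (real \<Rightarrow> real ^ 'n::finite ^ 'n) \<Rightarrow> bool" where
  "estimation_loop f A \<delta> y z \<longleftrightarrow> (\<forall>t\<ge>0. \<forall>i.
     ((\<lambda>s. y s $ i) has_real_derivative - partial i (f i) (z t $ i)) (at t within {0..}) \<and>
     (\<forall>j. ((\<lambda>s. z s $ i $ j) has_real_derivative
        - \<delta> i j * ((\<Sum>l\<in>UNIV. A $ i $ l * (z t $ i $ j - z t $ l $ j))
          + A $ i $ j * (z t $ i $ j - y t $ j))) (at t within {0..})))"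

lemma estimation_loop_exists:
  fixes f :: "'n::finite \<Rightarrow> real ^ 'n \<Rightarrow> real" and y0 :: "real ^ 'n" and z0 :: "real ^ 'n ^ 'n"
  assumes lip: "\<And>i. (l i)-lipschitz_on UNIV (partial i (f i))"
  shows "\<exists>y z. estimation_loop f A \<delta> y z \<and> y 0 = y0 \<and> z 0 = z0"
proof -
  define P :: "(real ^ 'n) \<times> (real ^ 'n ^ 'n) \<Rightarrow> real ^ 'n"
    where "P X = (\<chi> i. - partial i (f i) (snd X $ i))" for X
  define C :: "(real ^ 'n) \<times> (real ^ 'n ^ 'n) \<Rightarrow> real ^ 'n ^ 'n"
    where "C X = (\<chi> i j. - \<delta> i j * ((\<Sum>l\<in>UNIV. A $ i $ l * (snd X $ i $ j - snd X $ l $ j))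
          + A $ i $ j * (snd X $ i $ j - fst X $ j)))" for X
  have "(\<Sum>i\<in>UNIV. l i)-lipschitz_on UNIV P"
  proof (rule lipschitz_on_vec)
    fix i
    have "(l i)-lipschitz_on UNIV (\<lambda>X :: (real ^ 'n) \<times> (real ^ 'n ^ 'n). partial i (f i) (snd X $ i))"
    proof (rule lipschitz_onI)
      fix X Y :: "(real ^ 'n) \<times> (real ^ 'n ^ 'n)"
      have "dist (partial i (f i) (snd X $ i)) (partial i (f i) (snd Y $ i))
          \<le> l i * dist (snd X $ i) (snd Y $ i)"
        using lip by (rule lipschitz_onD) auto
      also have "\<dots> \<le> l i * dist X Y"
        using dist_vec_nth_le[of "snd X" i "snd Y"] dist_snd_le[of X Y]
        by (intro mult_left_mono lipschitz_on_nonneg[OF lip]) linarith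
      finally show "dist (partial i (f i) (snd X $ i)) (partial i (f i) (snd Y $ i)) \<le> l i * dist X Y" .
    qed (rule lipschitz_on_nonneg[OF lip])
    then show "(l i)-lipschitz_on UNIV (\<lambda>X. P X $ i)"
      by (simp add: P_def)
  qed
  moreover have "linear C"
  proof (rule linearI)
    fix X Y :: "(real ^ 'n) \<times> (real ^ 'n ^ 'n)" and c :: real
    show "C (X + Y) = C X + C Y"
      by (simp add: C_def vec_eq_iff algebra_simps sum.distrib sum_subtractf sum_distrib_left)
    show "C (c *\<^sub>R X) = c *\<^sub>R C X"
      by (simp add: C_def vec_eq_iff algebra_simps sum_distrib_left sum_subtractf)
  qed
  then obtain K where "K-lipschitz_on UNIV C"
    using bounded_linear.lipschitz_boundE linear_conv_bounded_linear by metis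
  ultimately have F: "(sqrt ((\<Sum>i\<in>UNIV. l i)\<^sup>2 + K\<^sup>2))-lipschitz_on UNIV (\<lambda>X. (P X, C X))"
    by (rule lipschitz_on_Pair)
  obtain X where X0: "X 0 = (y0, z0)"
    and X: "\<And>t. 0 \<le> t \<Longrightarrow> (X has_vector_derivative (P (X t), C (X t))) (at t within {0..})"
    using global_solution_of_lipschitz_field[of _ "\<lambda>t X. (P X, C X)" "(y0, z0)", OF F]
    by (metis continuous_on_const order_refl)
  have y: "((\<lambda>s. fst (X s) $ i) has_vector_derivative P (X t) $ i) (at t within {0..})"
    and z: "((\<lambda>s. snd (X s) $ i $ j) has_vector_derivative C (X t) $ i $ j) (at t within {0..})"
    if "0 \<le> t" for t i j
    using bounded_linear.has_vector_derivative[OF bounded_linear_vec_nth[of i],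
        OF bounded_linear.has_vector_derivative[OF bounded_linear_fst X[OF that]]]
      bounded_linear.has_vector_derivative[OF bounded_linear_vec_nth[of j],
        OF bounded_linear.has_vector_derivative[OF bounded_linear_vec_nth[of i],
        OF bounded_linear.has_vector_derivative[OF bounded_linear_snd X[OF that]]]]
    by simp_all
  have "estimation_loop f A \<delta> (\<lambda>t. fst (X t)) (\<lambda>t. snd (X t))"
    unfolding estimation_loop_def has_real_derivative_iff_has_vector_derivative
    using y z by (simp add: P_def C_def)
  then show ?thesis using X0 by (intro exI[of _ "\<lambda>t. fst (X t)"] exI[of _ "\<lambda>t. snd (X t)"]) simp
qed

text \<open>Half the squared distance of \<open>y\<close> to the equilibrium plus weighted squares of the estimation errors. The
weights \<open>1 / \<delta>b i j\<close> cancel the gains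
of the individual estimates, so that the derivative contains the symmetric consensus form with the
common factor \<open>\<delta>\<close>.\<close>

definition lyapunov :: "real ^ 'n \<Rightarrow> ('n \<Rightarrow> 'n \<Rightarrow> real) \<Rightarrow> real ^ 'n \<Rightarrow> real ^ 'n::finite ^ 'n \<Rightarrow> real" where
  "lyapunov xs \<delta>b y z = (\<Sum>j\<in>UNIV. (y $ j - xs $ j)\<^sup>2) / 2
     + (\<Sum>i\<in>UNIV. \<Sum>j\<in>UNIV. (z $ i $ j - y $ j)\<^sup>2 / (2 * \<delta>b i j))"

definition lyapunov_rate ::
  "('n \<Rightarrow> real ^ 'n \<Rightarrow> real) \<Rightarrow> real ^ 'n ^ 'n \<Rightarrow> real ^ 'n \<Rightarrow> ('n \<Rightarrow> 'n \<Rightarrow> real) \<Rightarrow> real \<Rightarrow>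
   real ^ 'n \<Rightarrow> real ^ 'n::finite ^ 'n \<Rightarrow> real" where
  "lyapunov_rate f A xs \<delta>b \<delta> y z =
     - (\<Sum>j\<in>UNIV. (y $ j - xs $ j) * partial j (f j) (z $ j))
     - \<delta> * consensus_form A (\<chi> i j. z $ i $ j - y $ j)
     + (\<Sum>i\<in>UNIV. \<Sum>j\<in>UNIV. (z $ i $ j - y $ j) * partial j (f j) (z $ j) / \<delta>b i j)"

lemma lyapunov_deriv:
  fixes y :: "real \<Rightarrow> real ^ 'n::finite" and z :: "real \<Rightarrow> real ^ 'n ^ 'n"
  assumes loop: "estimation_loop f A (\<lambda>i j. \<delta> * \<delta>b i j) y z" and \<delta>b: "\<And>i j. 0 < \<delta>b i j"
    and t: "0 \<le> t"
  shows "((\<lambda>t. lyapunov xs \<delta>b (y t) (z t)) has_real_derivative lyapunov_rate f A xs \<delta>b \<delta> (y t) (z t))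
    (at t within {0..})"
proof -
  define D where "D j = partial j (f j) (z t $ j)" for j
  define c where "c i j = (\<Sum>l\<in>UNIV. A $ i $ l * (z t $ i $ j - z t $ l $ j))
          + A $ i $ j * (z t $ i $ j - y t $ j)" for i j
  have y: "((\<lambda>s. y s $ j) has_real_derivative - D j) (at t within {0..})"
    and z: "((\<lambda>s. z s $ i $ j) has_real_derivative - (\<delta> * \<delta>b i j) * c i j) (at t within {0..})" for i j
    using loop t by (auto simp: estimation_loop_def D_def c_def)
  have 1: "((\<lambda>s. (y s $ j - xs $ j)\<^sup>2) has_real_derivative 2 * ((y t $ j - xs $ j) * - D j)) (at t within {0..})" for j
    by (rule derivative_eq_intros y refl)+ simp
  have 2: "((\<lambda>s. (z s $ i $ j - y s $ j)\<^sup>2 / (2 * \<delta>b i j)) has_real_derivative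
      (z t $ i $ j - y t $ j) * D j / \<delta>b i j - \<delta> * ((z t $ i $ j - y t $ j) * c i j))
      (at t within {0..})" for i j
  proof -
    have "((\<lambda>s. (z s $ i $ j - y s $ j)\<^sup>2 / (2 * \<delta>b i j)) has_real_derivative
      2 * (z t $ i $ j - y t $ j) * (- (\<delta> * \<delta>b i j) * c i j - - D j) / (2 * \<delta>b i j)) (at t within {0..})"
      by (rule DERIV_cdivide) (rule derivative_eq_intros y z refl | simp)+
    also have "2 * (z t $ i $ j - y t $ j) * (- (\<delta> * \<delta>b i j) * c i j - - D j) / (2 * \<delta>b i j)
      = (z t $ i $ j - y t $ j) * D j / \<delta>b i j - \<delta> * ((z t $ i $ j - y t $ j) * c i j)"
      using \<delta>b[of i j] by (simp add: field_simps)
    finally show ?thesis .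
  qed
  have "((\<lambda>t. lyapunov xs \<delta>b (y t) (z t)) has_real_derivative
     (\<Sum>j\<in>UNIV. 2 * ((y t $ j - xs $ j) * - D j)) / 2
     + (\<Sum>i\<in>UNIV. \<Sum>j\<in>UNIV. (z t $ i $ j - y t $ j) * D j / \<delta>b i j - \<delta> * ((z t $ i $ j - y t $ j) * c i j)))
    (at t within {0..})"
    unfolding lyapunov_def by (intro DERIV_add DERIV_cdivide DERIV_sum 1 2)
  also have "(\<Sum>j\<in>UNIV. 2 * ((y t $ j - xs $ j) * - D j)) / 2
     + (\<Sum>i\<in>UNIV. \<Sum>j\<in>UNIV. (z t $ i $ j - y t $ j) * D j / \<delta>b i j - \<delta> * ((z t $ i $ j - y t $ j) * c i j))
    = lyapunov_rate f A xs \<delta>b \<delta> (y t) (z t)"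
    unfolding lyapunov_rate_def consensus_form_def D_def c_def
    by (simp add: sum_subtractf sum_negf flip: sum_distrib_left)
  finally show ?thesis .
qed

text \<open>Let \<open>p\<close> be the distance of \<open>y\<close> to the equilibrium and \<open>q\<close> the norm of the estimation errors. Strong monotonicity
contributes \<open>- m p\<^sup>2\<close> and consensus \<open>- \<delta> \<mu> q\<^sup>2\<close>. The gradients are evaluated at the estimates instead of at
\<open>y\<close>, and \<open>y\<close> moves while the estimates follow it; by the Lipschitz conditions this costs at most a multiple
of \<open>p q + q\<^sup>2\<close>. For large \<open>\<delta>\<close>, Young's inequality absorbs it, and the rate is at most \<open>- (m / 2) p\<^sup>2 - q\<^sup>2\<close>.\<close>

lemma lyapunov_decrease:
  fixes f :: "'n::finite \<Rightarrow> real ^ 'n \<Rightarrow> real"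
  assumes lip: "\<And>i. (l i)-lipschitz_on UNIV (partial i (f i))"
    and m: "0 < m"
    and mono: "\<And>x z. m * (norm (x - z))\<^sup>2 \<le> (x - z) \<bullet> (pseudogradient f x - pseudogradient f z)"
    and coercive: "\<And>\<eta>. \<mu> * (norm \<eta>)\<^sup>2 \<le> consensus_form A \<eta>" and \<mu>: "0 < \<mu>"
    and \<delta>b: "\<And>i j. 0 < \<delta>b i j"
    and zero: "pseudogradient f xs = 0"
  obtains \<delta>s c where "0 < \<delta>s" "0 < c"
    "\<And>\<delta> y z. \<delta>s < \<delta> \<Longrightarrow> lyapunov_rate f A xs \<delta>b \<delta> y z \<le> - c * lyapunov xs \<delta>b y z"
proof -
  define \<Lambda> where "\<Lambda> = (\<Sum>i\<in>UNIV. l i)"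
  define \<kappa> where "\<kappa> = (\<Sum>i\<in>UNIV. \<Sum>j\<in>UNIV. 1 / \<delta>b i j)"
  define a where "a = \<Lambda> * (1 + \<kappa>)"
  define \<delta>s where "\<delta>s = (\<kappa> * \<Lambda> + a\<^sup>2 / (2 * m) + 1) / \<mu>"
  define c where "c = min m (2 / (\<kappa> + 1))"
  have l: "0 \<le> l i" for i by (rule lipschitz_on_nonneg[OF lip])
  have \<Lambda>: "0 \<le> \<Lambda>" and l\<Lambda>: "l i \<le> \<Lambda>" for i
    unfolding \<Lambda>_def using l by (auto intro: sum_nonneg member_le_sum)
  have \<kappa>: "0 \<le> \<kappa>" unfolding \<kappa>_def using \<delta>b by (intro sum_nonneg) (simp add: less_imp_le)
  have crit: "partial j (f j) xs = 0" for j
    using zero by (simp add: pseudogradient_def vec_eq_iff)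
  have pos: "0 < \<kappa> * \<Lambda> + a\<^sup>2 / (2 * m) + 1" using \<kappa> \<Lambda> m by (intro add_nonneg_pos add_nonneg_nonneg) auto
  have \<delta>s: "0 < \<delta>s" using pos \<mu> by (simp add: \<delta>s_def)
  show thesis
  proof (rule that[OF \<delta>s])
    show "0 < c" using m \<kappa> by (simp add: c_def)
    fix \<delta> :: real and y z
    assume \<delta>: "\<delta>s < \<delta>"
    define \<eta> :: "real ^ 'n ^ 'n" where "\<eta> = (\<chi> i j. z $ i $ j - y $ j)"
    define p where "p = norm (y - xs)"
    define q where "q = norm \<eta>"
    define D where "D j = partial j (f j) (z $ j)" for j
    have p0: "0 \<le> p" and q0: "0 \<le> q" by (auto simp: p_def q_def)
    have row: "norm (z $ j - y) \<le> q" for j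
    proof -
      have "z $ j - y = \<eta> $ j" by (simp add: \<eta>_def vec_eq_iff)
      then show ?thesis using Finite_Cartesian_Product.norm_nth_le[of \<eta> j] by (simp add: q_def)
    qed
    have entry: "\<bar>z $ i $ j - y $ j\<bar> \<le> q" for i j
      using component_le_norm_cart[of "z $ i - y" j] row[of i] by simp
    have D_near: "\<bar>D j - partial j (f j) y\<bar> \<le> l j * q" for j
    proof -
      have "\<bar>D j - partial j (f j) y\<bar> \<le> l j * norm (z $ j - y)"
        using lipschitz_on_normD[OF lip, of "z $ j" y j] by (simp add: D_def)
      also have "\<dots> \<le> l j * q" using row l by (intro mult_left_mono)
      finally show ?thesis .
    qed
    have D_bound: "\<bar>D j\<bar> \<le> \<Lambda> * (p + q)" for j
    proof -
      have "\<bar>partial j (f j) y\<bar> \<le> l j * p"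
        using lipschitz_on_normD[OF lip, of y xs j] crit by (simp add: p_def)
      then have "\<bar>D j\<bar> \<le> l j * (p + q)" using D_near[of j] by (simp add: distrib_left)
      also have "\<dots> \<le> \<Lambda> * (p + q)" using l\<Lambda> p0 q0 by (intro mult_right_mono) auto
      finally show ?thesis .
    qed
    have drift: "- (\<Sum>j\<in>UNIV. (y $ j - xs $ j) * D j) \<le> - m * p\<^sup>2 + \<Lambda> * p * q"
    proof -
      have "m * p\<^sup>2 \<le> (\<Sum>j\<in>UNIV. (y $ j - xs $ j) * partial j (f j) y)"
        using mono[of y xs] unfolding zero p_def by (simp add: inner_vec_def pseudogradient_def)
      moreover have "(\<Sum>j\<in>UNIV. - ((y $ j - xs $ j) * (D j - partial j (f j) y))) \<le> (\<Sum>j\<in>UNIV. p * (l j * q))"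
      proof (rule sum_mono)
        fix j
        have "\<bar>(y $ j - xs $ j) * (D j - partial j (f j) y)\<bar> \<le> p * (l j * q)"
          unfolding abs_mult using component_le_norm_cart[of "y - xs" j] D_near[of j] p0
          by (intro mult_mono) (auto simp: p_def)
        then show "- ((y $ j - xs $ j) * (D j - partial j (f j) y)) \<le> p * (l j * q)" by linarith
      qed
      moreover have "(\<Sum>j\<in>UNIV. p * (l j * q)) = \<Lambda> * p * q"
        by (simp add: \<Lambda>_def sum_distrib_left sum_distrib_right mult_ac)
      ultimately show ?thesis
        by (simp add: right_diff_distrib sum_subtractf sum_negf)
    qed
    have cross: "(\<Sum>i\<in>UNIV. \<Sum>j\<in>UNIV. (z $ i $ j - y $ j) * D j / \<delta>b i j) \<le> \<kappa> * \<Lambda> * (p + q) * q"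
    proof -
      have "(\<Sum>i\<in>UNIV. \<Sum>j\<in>UNIV. (z $ i $ j - y $ j) * D j / \<delta>b i j)
          \<le> (\<Sum>i\<in>UNIV. \<Sum>j\<in>UNIV. q * (\<Lambda> * (p + q)) * (1 / \<delta>b i j))"
      proof (intro sum_mono)
        fix i j
        have "(z $ i $ j - y $ j) * D j \<le> \<bar>z $ i $ j - y $ j\<bar> * \<bar>D j\<bar>"
          by (metis abs_ge_self abs_mult)
        also have "\<dots> \<le> q * (\<Lambda> * (p + q))" using entry D_bound q0 by (intro mult_mono) auto
        finally show "(z $ i $ j - y $ j) * D j / \<delta>b i j \<le> q * (\<Lambda> * (p + q)) * (1 / \<delta>b i j)"
          using \<delta>b[of i j] by (simp add: divide_right_mono)
      qed
      also have "\<dots> = q * (\<Lambda> * (p + q)) * \<kappa>" by (simp only: \<kappa>_def sum_distrib_left)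
      finally show ?thesis by (simp add: mult_ac)
    qed
    have gain: "(\<kappa> * \<Lambda> + a\<^sup>2 / (2 * m) + 1) * q\<^sup>2 \<le> \<delta> * consensus_form A \<eta>"
    proof -
      have "(\<kappa> * \<Lambda> + a\<^sup>2 / (2 * m) + 1) * q\<^sup>2 = \<delta>s * (\<mu> * q\<^sup>2)" using \<mu> by (simp add: \<delta>s_def)
      also have "\<dots> \<le> \<delta> * consensus_form A \<eta>"
        using coercive[of \<eta>] \<delta> \<delta>s \<mu> by (intro mult_mono) (auto simp: q_def)
      finally show ?thesis .
    qed
    \<comment> \<open>Complete the square in \<open>m p - a q\<close>.\<close>
    have young: "a * (p * q) \<le> m / 2 * p\<^sup>2 + a\<^sup>2 / (2 * m) * q\<^sup>2"
    proof -
      have "0 \<le> (m * p - a * q)\<^sup>2 / (2 * m)" using m by simp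
      also have "\<dots> = m / 2 * p\<^sup>2 + a\<^sup>2 / (2 * m) * q\<^sup>2 - a * (p * q)"
        using m by (simp add: power2_eq_square field_simps)
      finally show ?thesis by simp
    qed
    have "lyapunov_rate f A xs \<delta>b \<delta> y z \<le> (- m * p\<^sup>2 + \<Lambda> * p * q) - (\<kappa> * \<Lambda> + a\<^sup>2 / (2 * m) + 1) * q\<^sup>2
        + \<kappa> * \<Lambda> * (p + q) * q"
      unfolding lyapunov_rate_def D_def[symmetric] \<eta>_def[symmetric] using drift cross gain by linarith
    also have "\<dots> = - m * p\<^sup>2 + a * (p * q) - (a\<^sup>2 / (2 * m) + 1) * q\<^sup>2"
      by (simp add: a_def power2_eq_square algebra_simps)
    also have "\<dots> \<le> - (m / 2) * p\<^sup>2 - q\<^sup>2" using young by (simp add: algebra_simps)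
    finally have rate: "lyapunov_rate f A xs \<delta>b \<delta> y z \<le> - (m / 2) * p\<^sup>2 - q\<^sup>2" .
    have "(\<Sum>i\<in>UNIV. \<Sum>j\<in>UNIV. (z $ i $ j - y $ j)\<^sup>2 / (2 * \<delta>b i j))
        \<le> (\<Sum>i\<in>UNIV. \<Sum>j\<in>UNIV. q\<^sup>2 / 2 * (1 / \<delta>b i j))"
    proof (intro sum_mono)
      fix i j
      have "(z $ i $ j - y $ j)\<^sup>2 \<le> q\<^sup>2" using entry[of i j] q0 by (simp add: abs_le_square_iff[symmetric])
      then show "(z $ i $ j - y $ j)\<^sup>2 / (2 * \<delta>b i j) \<le> q\<^sup>2 / 2 * (1 / \<delta>b i j)"
        using \<delta>b[of i j] by (simp add: field_simps)
    qed
    also have "\<dots> = q\<^sup>2 / 2 * \<kappa>" by (simp add: \<kappa>_def sum_distrib_left)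
    finally have "(\<Sum>i\<in>UNIV. \<Sum>j\<in>UNIV. (z $ i $ j - y $ j)\<^sup>2 / (2 * \<delta>b i j)) \<le> q\<^sup>2 / 2 * \<kappa>" .
    moreover have "(\<Sum>j\<in>UNIV. (y $ j - xs $ j)\<^sup>2) = p\<^sup>2"
      unfolding p_def power2_norm_eq_inner inner_vec_def by (simp add: power2_eq_square)
    ultimately have "lyapunov xs \<delta>b y z \<le> p\<^sup>2 / 2 + q\<^sup>2 / 2 * \<kappa>"
      by (simp only: lyapunov_def)
    then have "c * lyapunov xs \<delta>b y z \<le> c * (p\<^sup>2 / 2 + q\<^sup>2 / 2 * \<kappa>)"
      using \<open>0 < c\<close> by (intro mult_left_mono) auto
    also have "\<dots> \<le> m * (p\<^sup>2 / 2) + 2 / (\<kappa> + 1) * (q\<^sup>2 / 2 * \<kappa>)"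
      unfolding distrib_left using \<kappa> by (intro add_mono mult_right_mono) (auto simp: c_def)
    also have "2 / (\<kappa> + 1) * (q\<^sup>2 / 2 * \<kappa>) \<le> q\<^sup>2"
      using \<kappa> by (simp add: field_simps)
    finally show "lyapunov_rate f A xs \<delta>b \<delta> y z \<le> - c * lyapunov xs \<delta>b y z"
      using rate by simp
  qed
qed

text \<open>The Lyapunov function decays exponentially and dominates every squared error. The estimates
therefore converge to the equilibrium together with \<open>y\<close>, and the gradients evaluated at them converge
to the gradients at the equilibrium, which vanish.\<close>

lemma estimation_loop_converges:
  fixes f :: "'n::finite \<Rightarrow> real ^ 'n \<Rightarrow> real"
  assumes card: "CARD('n) \<ge> 2" and adj: "adjacency_matrix E A" and graph: "undirected_connected E A"
    and lip: "\<And>i. (l i)-lipschitz_on UNIV (partial i (f i))"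
    and m: "0 < m"
    and mono: "\<And>x z. m * (norm (x - z))\<^sup>2 \<le> (x - z) \<bullet> (pseudogradient f x - pseudogradient f z)"
    and \<delta>b: "\<And>i j. 0 < \<delta>b i j"
    and zero: "pseudogradient f xs = 0"
  obtains \<delta>s where "0 < \<delta>s"
    "\<And>\<delta> y z j. \<delta>s < \<delta> \<Longrightarrow> estimation_loop f A (\<lambda>i j. \<delta> * \<delta>b i j) y z \<Longrightarrow>
       ((\<lambda>t. y t $ j) \<longlongrightarrow> xs $ j) at_top"
    "\<And>\<delta> y z i. \<delta>s < \<delta> \<Longrightarrow> estimation_loop f A (\<lambda>i j. \<delta> * \<delta>b i j) y z \<Longrightarrow>
       ((\<lambda>t. partial i (f i) (z t $ i)) \<longlongrightarrow> 0) at_top"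
proof -
  obtain \<mu> where \<mu>: "0 < \<mu>" and coercive: "\<And>\<eta>. \<mu> * (norm \<eta>)\<^sup>2 \<le> consensus_form A \<eta>"
    by (rule consensus_form_coercive[OF card adj graph]) (rule that)
  obtain \<delta>s c where "0 < \<delta>s" and c: "0 < c"
    and decrease: "\<And>\<delta> y z. \<delta>s < \<delta> \<Longrightarrow> lyapunov_rate f A xs \<delta>b \<delta> y z \<le> - c * lyapunov xs \<delta>b y z"
    by (rule lyapunov_decrease[where \<delta>b = \<delta>b, OF lip m mono coercive \<mu> \<delta>b zero]) (rule that)
  have lim: "((\<lambda>t. y t $ j) \<longlongrightarrow> xs $ j) at_top \<and> ((\<lambda>t. z t $ i $ j) \<longlongrightarrow> xs $ j) at_top"
    if \<delta>: "\<delta>s < \<delta>" and loop: "estimation_loop f A (\<lambda>i j. \<delta> * \<delta>b i j) y z" for \<delta> y z i j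
  proof -
    define S where "S t = lyapunov xs \<delta>b (y t) (z t)" for t
    have terms: "0 \<le> (z t $ i $ j - y t $ j)\<^sup>2 / (2 * \<delta>b i j)" for t i j
      using \<delta>b[of i j] by simp
    have y_le: "(y t $ j - xs $ j)\<^sup>2 \<le> 2 * S t" for t
    proof -
      have "(y t $ j - xs $ j)\<^sup>2 \<le> (\<Sum>j\<in>UNIV. (y t $ j - xs $ j)\<^sup>2)"
        by (rule member_le_sum) auto
      moreover have "0 \<le> (\<Sum>i\<in>UNIV. \<Sum>j\<in>UNIV. (z t $ i $ j - y t $ j)\<^sup>2 / (2 * \<delta>b i j))"
        by (intro sum_nonneg terms)
      ultimately show ?thesis by (simp add: S_def lyapunov_def)
    qed
    have z_le: "(z t $ i $ j - y t $ j)\<^sup>2 \<le> 2 * \<delta>b i j * S t" for t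
    proof -
      have "(z t $ i $ j - y t $ j)\<^sup>2 / (2 * \<delta>b i j) \<le> (\<Sum>j\<in>UNIV. (z t $ i $ j - y t $ j)\<^sup>2 / (2 * \<delta>b i j))"
        by (rule member_le_sum) (auto intro: terms)
      also have "\<dots> \<le> (\<Sum>i\<in>UNIV. \<Sum>j\<in>UNIV. (z t $ i $ j - y t $ j)\<^sup>2 / (2 * \<delta>b i j))"
        by (rule member_le_sum) (auto intro: sum_nonneg terms)
      also have "\<dots> \<le> S t" by (simp add: S_def lyapunov_def sum_nonneg)
      finally show ?thesis using \<delta>b[of i j] by (simp add: field_simps)
    qed
    have S0: "0 \<le> S t" for t using y_le[of t] zero_le_power2[of "y t $ j - xs $ j"] by linarith
    have "((\<lambda>t. exp (- t)) \<longlongrightarrow> (0::real)) at_top"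
      by (rule filterlim_compose[OF exp_at_bot filterlim_uminus_at_bot_at_top])
    then have "((\<lambda>t. exp (- (c * t))) \<longlongrightarrow> (0::real)) at_top"
      by (rule filterlim_compose)
        (rule filterlim_tendsto_pos_mult_at_top[OF tendsto_const c filterlim_ident])
    then have bound_lim: "((\<lambda>t. exp (- (c * t)) * S 0) \<longlongrightarrow> 0) at_top"
      by (rule tendsto_mult_left_zero)
    have S_le: "S t \<le> exp (- (c * t)) * S 0" if t: "0 \<le> t" for t
      using exponential_comparison[of 0 t S "\<lambda>t. lyapunov_rate f A xs \<delta>b \<delta> (y t) (z t)" "{0..}" c]
        lyapunov_deriv[OF loop \<delta>b] decrease[OF \<delta>] t by (simp add: S_def[abs_def])
    have S_lim: "(S \<longlongrightarrow> 0) at_top"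
      by (rule tendsto_sandwich[OF _ _ tendsto_const bound_lim])
        (auto intro: S0 S_le eventually_mono[OF eventually_ge_at_top[of 0]])
    have "((\<lambda>t. (y t $ j - xs $ j)\<^sup>2) \<longlongrightarrow> 0) at_top"
      by (rule tendsto_sandwich[OF _ _ tendsto_const tendsto_mult_right_zero[OF S_lim, of 2]])
        (simp_all add: y_le)
    then have y_lim: "((\<lambda>t. y t $ j - xs $ j) \<longlongrightarrow> 0) at_top" by (simp add: power_tendsto_0_iff)
    have "((\<lambda>t. (z t $ i $ j - y t $ j)\<^sup>2) \<longlongrightarrow> 0) at_top"
      by (rule tendsto_sandwich[OF _ _ tendsto_const tendsto_mult_right_zero[OF S_lim, of "2 * \<delta>b i j"]])
        (simp_all add: z_le)
    then have "((\<lambda>t. z t $ i $ j - y t $ j) \<longlongrightarrow> 0) at_top" by (simp add: power_tendsto_0_iff)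
    from tendsto_add[OF this y_lim] have "((\<lambda>t. z t $ i $ j - xs $ j) \<longlongrightarrow> 0) at_top" by simp
    then show ?thesis using y_lim by (simp add: LIM_zero_iff)
  qed
  show thesis
  proof (rule that[OF \<open>0 < \<delta>s\<close>])
    fix \<delta> y z j
    assume A: "\<delta>s < \<delta>" "estimation_loop f A (\<lambda>i j. \<delta> * \<delta>b i j) y z"
    show "((\<lambda>t. y t $ j) \<longlongrightarrow> xs $ j) at_top" using lim[OF A] by blast
    have "((\<lambda>t. z t $ j) \<longlongrightarrow> xs) at_top" using lim[OF A] by (intro vec_tendstoI) blast
    moreover have "isCont (partial j (f j)) xs"
      using lipschitz_on_continuous_on[OF lip] by (simp add: continuous_on_eq_continuous_at)
    ultimately have "((\<lambda>t. partial j (f j) (z t $ j)) \<longlongrightarrow> partial j (f j) xs) at_top"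
      by (rule isCont_tendsto_compose[rotated])
    then show "((\<lambda>t. partial j (f j) (z t $ j)) \<longlongrightarrow> 0) at_top"
      using zero by (simp add: pseudogradient_def vec_eq_iff)
  qed
qed

section \<open>The closed loop\<close>

text \<open>The cascade structure: the estimation loop runs by itself, and each player is driven by its output.\<close>

lemma closed_loop_solution_iff:
  "closed_loop_solution f \<phi> b \<theta> A \<delta> x v k \<theta>h y z \<longleftrightarrow>
     estimation_loop f A \<delta> y z \<and>
     (\<forall>i. player_loop (b i) (\<theta> i) (\<phi> i) (\<lambda>t. y t $ i) (\<lambda>t. - partial i (f i) (z t $ i)) {0..}
        (\<lambda>t. x t $ i) (\<lambda>t. v t $ i) (\<lambda>t. k t $ i) (\<lambda>t. \<theta>h t $ i))"
  unfolding closed_loop_solution_def estimation_loop_def player_loop_def Let_def atLeast_iff Ball_def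
  by blast

lemma bounded_if_convergent_at_top:
  fixes g :: "real \<Rightarrow> real"
  assumes cont: "continuous_on {0..} g" and lim: "(g \<longlongrightarrow> L) at_top"
  obtains M where "\<And>t. 0 \<le> t \<Longrightarrow> \<bar>g t\<bar> \<le> M"
proof -
  obtain T where T: "\<And>t. T \<le> t \<Longrightarrow> \<bar>g t - L\<bar> < 1"
    using tendstoD[OF lim, of 1] by (auto simp: eventually_at_top_linorder dist_real_def)
  have "bounded (g ` {0..T})"
    by (intro compact_imp_bounded compact_continuous_image continuous_on_subset[OF cont]) auto
  then obtain B where B: "\<And>t. t \<in> {0..T} \<Longrightarrow> \<bar>g t\<bar> \<le> B"
    unfolding bounded_iff by fastforce
  have "\<bar>g t\<bar> \<le> max B (\<bar>L\<bar> + 1)" if "0 \<le> t" for t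
  proof (cases "t \<le> T")
    case True
    then show ?thesis using B[of t] that by simp
  next
    case False
    then show ?thesis using T[of t] by simp
  qed
  then show thesis by (rule that)
qed

lemma estimation_loop_bounded:
  fixes f :: "'n::finite \<Rightarrow> real ^ 'n \<Rightarrow> real"
  assumes loop: "estimation_loop f A \<delta> y z"
    and lip: "\<And>i. (l i)-lipschitz_on UNIV (partial i (f i))"
    and y_lim: "((\<lambda>t. y t $ i) \<longlongrightarrow> c) at_top"
    and D_lim: "((\<lambda>t. partial i (f i) (z t $ i)) \<longlongrightarrow> 0) at_top"
  obtains M where "\<And>t. 0 \<le> t \<Longrightarrow> \<bar>y t $ i\<bar> \<le> M"
    "\<And>t. 0 \<le> t \<Longrightarrow> \<bar>- partial i (f i) (z t $ i)\<bar> \<le> M"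
    "continuous_on {0..} (\<lambda>t. - partial i (f i) (z t $ i))"
proof -
  have "continuous_on {0..} (\<lambda>t. y t $ i)"
    using loop by (intro DERIV_continuous_on) (auto simp: estimation_loop_def)
  then obtain M1 where M1: "\<And>t. 0 \<le> t \<Longrightarrow> \<bar>y t $ i\<bar> \<le> M1"
    using y_lim by (rule bounded_if_convergent_at_top) (rule that)
  have "continuous_on {0..} (\<lambda>t. z t $ i $ j)" for j
    using loop by (intro DERIV_continuous_on) (auto simp: estimation_loop_def)
  then have "continuous_on {0..} (\<lambda>t. z t $ i)"
    unfolding continuous_on_def by (blast intro: vec_tendstoI)
  then have cont: "continuous_on {0..} (\<lambda>t. partial i (f i) (z t $ i))"
    by (rule continuous_on_compose2[OF lipschitz_on_continuous_on[OF lip]]) auto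
  then obtain M2 where M2: "\<And>t. 0 \<le> t \<Longrightarrow> \<bar>partial i (f i) (z t $ i)\<bar> \<le> M2"
    using D_lim by (rule bounded_if_convergent_at_top) (rule that)
  show thesis
    by (rule that[of "max M1 M2"]) (use M1 M2 cont in \<open>auto intro: le_max_iff_disj[THEN iffD2] continuous_on_minus\<close>)
qed

theorem theorem2:
  fixes f :: "'n::finite \<Rightarrow> real ^ 'n \<Rightarrow> real"
    and \<phi> :: "'n \<Rightarrow> real \<Rightarrow> real"
    and b \<theta> l :: "'n \<Rightarrow> real"
    and E :: "('n \<times> 'n) set"
    and A :: "real ^ 'n ^ 'n"
    and \<delta>b :: "'n \<Rightarrow> 'n \<Rightarrow> real"
    and m :: real
  assumes players: "CARD('n) \<ge> 2"
    and b_nz: "\<And>i. b i \<noteq> 0"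
    and phi_smooth: "\<And>i. \<phi> i C1_differentiable_on UNIV"
    and f_smooth: "\<And>i. Ck 2 (f i)"
    and f_lipschitz: "\<And>i. (l i)-lipschitz_on UNIV (partial i (f i))"
    and m_pos: "m > 0"
    and strongly_monotone:
      "\<And>x z. (x - z) \<bullet> (pseudogradient f x - pseudogradient f z) \<ge> m * (norm (x - z))\<^sup>2"
    and adjacency: "adjacency_matrix E A"
    and graph: "undirected_connected E A"
    and phi_bounded: "\<And>i. bounded_on_bounded (\<phi> i)"
    and dphi_bounded: "\<And>i. bounded_on_bounded (deriv (\<phi> i))"
    and ddf_bounded: "\<And>i j. bounded_on_bounded (partial j (partial i (f i)))"
    and delta_pos: "\<And>i j. \<delta>b i j > 0"
  shows "\<exists>xs. nash_equilibrium f xs \<and> (\<forall>xs'. nash_equilibrium f xs' \<longrightarrow> xs' = xs) \<and>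
    (\<exists>\<delta>s>0. \<forall>\<delta>>\<delta>s. \<forall>x0 v0 k0 \<theta>0 y0 z0.
      (\<exists>x v k \<theta>h y z.
         closed_loop_solution f \<phi> b \<theta> A (\<lambda>i j. \<delta> * \<delta>b i j) x v k \<theta>h y z \<and>
         x 0 = x0 \<and> v 0 = v0 \<and> k 0 = k0 \<and> \<theta>h 0 = \<theta>0 \<and> y 0 = y0 \<and> z 0 = z0) \<and>
      (\<forall>x v k \<theta>h y z.
         closed_loop_solution f \<phi> b \<theta> A (\<lambda>i j. \<delta> * \<delta>b i j) x v k \<theta>h y z \<and>
         x 0 = x0 \<and> v 0 = v0 \<and> k 0 = k0 \<and> \<theta>h 0 = \<theta>0 \<and> y 0 = y0 \<and> z 0 = z0 \<longrightarrow>
         ((\<lambda>t. norm (x t - xs)) \<longlongrightarrow> 0) at_top \<and>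
         (\<forall>i. bounded ((\<lambda>t. k t $ i) ` {0..}) \<and> bounded ((\<lambda>t. \<theta>h t $ i) ` {0..}))))"
proof -
  have smooth: "Ck (Suc 1) (f i)" for i
    using f_smooth[of i] by (simp only: numeral_2_eq_2 One_nat_def)
  have nash: "nash_equilibrium f x \<longleftrightarrow> pseudogradient f x = 0" for x
    by (rule nash_equilibrium_iff[OF smooth less_imp_le[OF m_pos] strongly_monotone])
  have "(\<Sum>i\<in>UNIV. l i)-lipschitz_on UNIV (pseudogradient f)"
    by (rule lipschitz_on_vec) (simp add: pseudogradient_def f_lipschitz)
  then obtain xs where zero: "pseudogradient f xs = 0"
    by (rule strongly_monotone_has_zero[OF _ m_pos strongly_monotone])
  have unique: "x = xs" if "nash_equilibrium f x" for x
  proof -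
    have "m * (norm (x - xs))\<^sup>2 \<le> 0"
      using strongly_monotone[of x xs] that by (simp add: nash zero)
    then show ?thesis using m_pos by (simp add: mult_le_0_iff)
  qed
  obtain \<delta>s where \<delta>s: "0 < \<delta>s"
    and y_lim: "\<And>\<delta> y z j. \<delta>s < \<delta> \<Longrightarrow> estimation_loop f A (\<lambda>i j. \<delta> * \<delta>b i j) y z \<Longrightarrow>
       ((\<lambda>t. y t $ j) \<longlongrightarrow> xs $ j) at_top"
    and D_lim: "\<And>\<delta> y z i. \<delta>s < \<delta> \<Longrightarrow> estimation_loop f A (\<lambda>i j. \<delta> * \<delta>b i j) y z \<Longrightarrow>
       ((\<lambda>t. partial i (f i) (z t $ i)) \<longlongrightarrow> 0) at_top"
    by (rule estimation_loop_converges[where \<delta>b = \<delta>b, OF players adjacency graph f_lipschitz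
          m_pos strongly_monotone delta_pos zero]) (rule that)
  have exists: "\<exists>x v k \<theta>h y z.
         closed_loop_solution f \<phi> b \<theta> A (\<lambda>i j. \<delta> * \<delta>b i j) x v k \<theta>h y z \<and>
         x 0 = x0 \<and> v 0 = v0 \<and> k 0 = k0 \<and> \<theta>h 0 = \<theta>0 \<and> y 0 = y0 \<and> z 0 = z0"
    if \<delta>: "\<delta>s < \<delta>" for \<delta> x0 v0 k0 \<theta>0 y0 z0
  proof -
    obtain y z where loop: "estimation_loop f A (\<lambda>i j. \<delta> * \<delta>b i j) y z" and yz0: "y 0 = y0" "z 0 = z0"
      using estimation_loop_exists[OF f_lipschitz] by blast
    define Q where "Q i x v k h \<longleftrightarrow>
      player_loop (b i) (\<theta> i) (\<phi> i) (\<lambda>t. y t $ i) (\<lambda>t. - partial i (f i) (z t $ i)) {0..} x v k h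
        \<and> x 0 = x0 $ i \<and> v 0 = v0 $ i \<and> k 0 = k0 $ i \<and> h 0 = \<theta>0 $ i" for i x v k h
    have "\<exists>x v k h. Q i x v k h" for i
    proof -
      obtain M where "\<And>t. 0 \<le> t \<Longrightarrow> \<bar>y t $ i\<bar> \<le> M"
        "\<And>t. 0 \<le> t \<Longrightarrow> \<bar>- partial i (f i) (z t $ i)\<bar> \<le> M"
        "continuous_on {0..} (\<lambda>t. - partial i (f i) (z t $ i))"
        by (rule estimation_loop_bounded[OF loop f_lipschitz y_lim[OF \<delta> loop] D_lim[OF \<delta> loop]])
          (rule that)
      then show ?thesis
        unfolding Q_def using loop
        by (intro player_loop_exists[OF b_nz phi_smooth]) (auto simp: estimation_loop_def)
    qed
    then obtain x v k h where "\<And>i. Q i (x i) (v i) (k i) (h i)" by metis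
    then show ?thesis
      using loop yz0
      by (intro exI[of _ "\<lambda>t. \<chi> i. x i t"] exI[of _ "\<lambda>t. \<chi> i. v i t"] exI[of _ "\<lambda>t. \<chi> i. k i t"]
          exI[of _ "\<lambda>t. \<chi> i. h i t"] exI[of _ y] exI[of _ z])
        (simp add: closed_loop_solution_iff vec_eq_iff Q_def)
  qed
  have converges: "((\<lambda>t. norm (x t - xs)) \<longlongrightarrow> 0) at_top \<and>
         (\<forall>i. bounded ((\<lambda>t. k t $ i) ` {0..}) \<and> bounded ((\<lambda>t. \<theta>h t $ i) ` {0..}))"
    if \<delta>: "\<delta>s < \<delta>" and sol: "closed_loop_solution f \<phi> b \<theta> A (\<lambda>i j. \<delta> * \<delta>b i j) x v k \<theta>h y z"
    for \<delta> x v k \<theta>h y z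
  proof -
    have loop: "estimation_loop f A (\<lambda>i j. \<delta> * \<delta>b i j) y z"
      and player: "player_loop (b i) (\<theta> i) (\<phi> i) (\<lambda>t. y t $ i) (\<lambda>t. - partial i (f i) (z t $ i)) {0..}
        (\<lambda>t. x t $ i) (\<lambda>t. v t $ i) (\<lambda>t. k t $ i) (\<lambda>t. \<theta>h t $ i)" for i
      using sol by (auto simp: closed_loop_solution_iff)
    have *: "((\<lambda>t. x t $ i - y t $ i) \<longlongrightarrow> 0) at_top \<and> bounded ((\<lambda>t. k t $ i) ` {0..})
        \<and> bounded ((\<lambda>t. \<theta>h t $ i) ` {0..})" for i
    proof -
      obtain M where M: "\<And>t. 0 \<le> t \<Longrightarrow> \<bar>y t $ i\<bar> \<le> M"
        "\<And>t. 0 \<le> t \<Longrightarrow> \<bar>- partial i (f i) (z t $ i)\<bar> \<le> M"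
        by (rule estimation_loop_bounded[OF loop f_lipschitz y_lim[OF \<delta> loop] D_lim[OF \<delta> loop]])
          (rule that; assumption)
      have \<phi>: "continuous_on UNIV (\<phi> i)"
        by (rule C1_differentiable_imp_continuous_on[OF phi_smooth])
      have y: "((\<lambda>t. y t $ i) has_real_derivative - partial i (f i) (z t $ i)) (at t within {0..})" if "0 \<le> t" for t
        using loop that by (simp add: estimation_loop_def)
      have D0: "((\<lambda>t. - partial i (f i) (z t $ i)) \<longlongrightarrow> 0) at_top"
        using tendsto_minus[OF D_lim[OF \<delta> loop]] by simp
      show ?thesis
        using player_loop_converges[OF b_nz \<phi> player y M D0] by blast
    qed
    have "((\<lambda>t. x t $ i) \<longlongrightarrow> xs $ i) at_top" for i
      using tendsto_add[OF conjunct1[OF *[of i]] y_lim[OF \<delta> loop, of i]] by simp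
    then have "(x \<longlongrightarrow> xs) at_top" by (rule vec_tendstoI)
    then have "((\<lambda>t. norm (x t - xs)) \<longlongrightarrow> 0) at_top"
      by (rule tendsto_norm_zero[OF LIM_zero])
    moreover have "bounded ((\<lambda>t. k t $ i) ` {0..}) \<and> bounded ((\<lambda>t. \<theta>h t $ i) ` {0..})" for i
      by (rule conjunct2[OF *])
    ultimately show ?thesis by (intro conjI[OF _ allI])
  qed
  show ?thesis
  proof (rule exI[of _ xs], intro conjI)
    show "nash_equilibrium f xs" using zero nash by simp
    show "\<forall>xs'. nash_equilibrium f xs' \<longrightarrow> xs' = xs" using unique by simp
    show "\<exists>\<delta>s>0. \<forall>\<delta>>\<delta>s. \<forall>x0 v0 k0 \<theta>0 y0 z0.
      (\<exists>x v k \<theta>h y z.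
         closed_loop_solution f \<phi> b \<theta> A (\<lambda>i j. \<delta> * \<delta>b i j) x v k \<theta>h y z \<and>
         x 0 = x0 \<and> v 0 = v0 \<and> k 0 = k0 \<and> \<theta>h 0 = \<theta>0 \<and> y 0 = y0 \<and> z 0 = z0) \<and>
      (\<forall>x v k \<theta>h y z.
         closed_loop_solution f \<phi> b \<theta> A (\<lambda>i j. \<delta> * \<delta>b i j) x v k \<theta>h y z \<and>
         x 0 = x0 \<and> v 0 = v0 \<and> k 0 = k0 \<and> \<theta>h 0 = \<theta>0 \<and> y 0 = y0 \<and> z 0 = z0 \<longrightarrow>
         ((\<lambda>t. norm (x t - xs)) \<longlongrightarrow> 0) at_top \<and>
         (\<forall>i. bounded ((\<lambda>t. k t $ i) ` {0..}) \<and> bounded ((\<lambda>t. \<theta>h t $ i) ` {0..})))"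
      by (rule exI[of _ \<delta>s], intro conjI[OF \<delta>s] allI impI, rule conjI, erule exists,
          intro allI impI, elim conjE, rule converges)
  qed
qed

end
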